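(* Let $a \approx 0.567284$ be the unique positive root in the interval $(0,1)$ of the equation $\psi(t)=0$, where $$\psi(t) = -405 + 473 t + 402 t^2 + 38 t^3 + 3 t^4 + t^5,$$ and let $$\lambda= \frac{4 (486 - 261 a - 324 a^2 + 2 a^3 + 30 a^4 + 3 a^5)}{ 81 (1 + a)^3 (3 - 5 a)}=18.6095 \ldots .$$ Suppose that $f(z) = \sum_{k=0}^\infty a_k z^k$ is analytic in $\mathbb{D}$ and $|f(z)| \leq 1$ for all $z\in\mathbb{D}$. Then $$M(r):=\sum_{k=0}^\infty |a_k|r^k+\frac{16}{9}\left(\frac{S_r}{\pi}\right)+\lambda\left(\frac{S_r}{\pi}\right)^2 \leq 1 \quad\text{for all } 0\le r \leq \frac{1}{3}.$$ Equality is achieved, at $r=1/3$, for the function $f(z) = \dfrac{a-z}{1-az}$ (where $a\approx 0.567284$ is the unique root of $\psi(t)=0$ in $(0,1)$).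
   Context: $\mathbb{D}=\{z\in\mathbb{C}: |z|<1\}$ is the open unit disk. For $f(z)=\sum_{k=0}^\infty a_kz^k$ analytic in $\mathbb{D}$ and $0\le r<1$, $S_r=S_r(f)$ denotes the area of the image of the subdisk $|z|<r$ under $f$, counted with multiplicity, i.e. $\dfrac{S_r}{\pi}=\sum_{k=1}^\infty k|a_k|^2r^{2k}$. *)

theory Defs
  imports "HOL-Complex_Analysis.Complex_Analysis"
begin

definition psi :: "real \<Rightarrow> real" where
  "psi t = -405 + 473 * t + 402 * t^2 + 38 * t^3 + 3 * t^4 + t^5"

definition lambda_of :: "real \<Rightarrow> real" where
  "lambda_of a = 4 * (486 - 261 * a - 324 * a^2 + 2 * a^3 + 30 * a^4 + 3 * a^5)
                   / (81 * (1 + a)^3 * (3 - 5 * a))"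

(* The area of the image of the disk of radius r, each value w being counted as often as it
   is attained there.  For f nonconstant and holomorphic on the unit disk and r < 1 every value
   is attained finitely often on the disk, and the critical values, where counting with or
   without the order of the zero of f - w would differ, form a null set.  For constant f the
   integrand vanishes off a single point, so the area is 0.  Hence, for bounded holomorphic f
   and r < 1, image_area f r = pi * (\<Sum>k. k * |a_k|^2 * r^(2*k)). *)
definition image_area :: "(complex \<Rightarrow> complex) \<Rightarrow> real \<Rightarrow> real" where
  "image_area f r = (LINT w|lborel. real (card {z. norm z < r \<and> f z = w}))"

definition M :: "real \<Rightarrow> (complex \<Rightarrow> complex) \<Rightarrow> real \<Rightarrow> real" where
  "M l f r = (\<Sum>k. norm (fps_nth (fps_expansion f 0) k) * r^k)
               + 16 / 9 * (image_area f r / pi) + l * (image_area f r / pi)^2"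

end

theory Submission
  imports Defs
begin

text \<open>
  Let \<open>t = |a\<^sub>0|\<close>. Comparing \<open>f\<close> with the Moebius map \<open>(t - z) / (1 - t z)\<close> coefficientwise in the
  sense of Rogosinski gives \<open>|a\<^sub>1|\<^sup>2 + \<dots> + |a\<^sub>n|\<^sup>2 \<le> (1 - t\<^sup>2)\<^sup>2 (1 + t\<^sup>2 + \<dots> + t\<^bsup>2(n-1)\<^esup>)\<close>.
  Summation by parts against the decreasing weights \<open>k 9\<^bsup>-k\<^esup>\<close> bounds the area, and against a geometric
  weight, followed by Cauchy-Schwarz, bounds \<open>\<Sum> |a\<^sub>k| 3\<^bsup>-k\<^esup>\<close>; for \<open>t \<ge> 1/3\<close> both bounds are attained
  by the Moebius map. What remains is an inequality in \<open>t\<close> which for \<open>t \<ge> 1/3\<close> says that \<open>\<lambda>\<close> is at most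
  \<open>crit t\<close>, and \<open>a\<close> is the minimiser of \<open>crit\<close>, the logarithmic derivative of \<open>crit\<close> being a positive
  multiple of \<open>\<psi>\<close>.

  For the area only the inequality \<open>S\<^sub>r \<le> \<pi> \<Sum> k |a\<^sub>k|\<^sup>2 r\<^bsup>2k\<^esup>\<close> is needed, besides the value for the
  Moebius map, whose image of a disc is a disc. A preimage count is the limit of the number of cells of a
  dyadic grid whose image contains the given point, so Fatou's lemma reduces the area of the image with
  multiplicity to the standard bound for the measure of the image of each cell, without any injectivity.
\<close>

no_notation fps_nth (infixl "$" 75)

section \<open>Area of an image counted with multiplicity\<close>

text \<open>The standard bound for the measure of a differentiable image, recast with
  \<open>emeasure\<close> and \<open>nn_integral\<close> so that it can be summed over countably
  many pieces without discussing convergence.\<close>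

lemma emeasure_differentiable_image_le:
  fixes f :: "real^'n::{finite,wellorder} \<Rightarrow> real^'n::_"
  assumes S: "S \<in> sets lebesgue"
    and deriv: "\<And>x. x \<in> S \<Longrightarrow> (f has_derivative f' x) (at x within S)"
    and int: "(\<lambda>x. \<bar>det (matrix (f' x))\<bar>) integrable_on S"
  shows "f ` S \<in> sets lebesgue"
    and "emeasure lebesgue (f ` S)
      \<le> (\<integral>\<^sup>+x. ennreal \<bar>det (matrix (f' x))\<bar> * indicator S x \<partial>lebesgue)"
proof -
  have lm: "f ` S \<in> lmeasurable"
    by (rule measurable_differentiable_image [OF S deriv int])
  then show "f ` S \<in> sets lebesgue"
    by auto
  have "(\<integral>\<^sup>+x. ennreal \<bar>det (matrix (f' x))\<bar> * indicator S x \<partial>lebesgue)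
     = ennreal (integral S (\<lambda>x. \<bar>det (matrix (f' x))\<bar>))"
    unfolding nn_integral_completion
    by (intro nn_integral_has_integral_lebesgue' integrable_integral int) auto
  moreover have "emeasure lebesgue (f ` S) = ennreal (measure lebesgue (f ` S))"
    using lm by (intro emeasure_eq_ennreal_measure) (auto simp: fmeasurable_def)
  ultimately show "emeasure lebesgue (f ` S)
      \<le> (\<integral>\<^sup>+x. ennreal \<bar>det (matrix (f' x))\<bar> * indicator S x \<partial>lebesgue)"
    using measure_differentiable_image [OF S deriv int]
    by (simp add: ennreal_leI)
qed

section \<open>Dyadic cells\<close>

definition grid_cell :: "nat \<Rightarrow> real^'n \<Rightarrow> int^'n::finite" where
  "grid_cell n x = (\<chi> i. \<lfloor>2 ^ n * x $ i\<rfloor>)"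

text \<open>As soon as 2^n times the gap in some coordinate exceeds 1, the two floors in that
  coordinate differ.\<close>

lemma grid_cell_eventually_neq:
  assumes "x \<noteq> y"
  shows "\<forall>\<^sub>F n in sequentially. grid_cell n x \<noteq> grid_cell n y"
proof -
  obtain i where i: "x $ i \<noteq> y $ i"
    using assms by (auto simp: vec_eq_iff)
  obtain N where N: "1 / \<bar>x $ i - y $ i\<bar> < 2 ^ N"
    using real_arch_pow [of 2] by auto
  have "grid_cell n x \<noteq> grid_cell n y" if "n \<ge> N" for n
  proof
    assume eq: "grid_cell n x = grid_cell n y"
    have "(1::real) < 2 ^ N * \<bar>x $ i - y $ i\<bar>"
      using N i by (simp add: field_simps)
    also have "\<dots> \<le> 2 ^ n * \<bar>x $ i - y $ i\<bar>"
      using that by (intro mult_right_mono power_increasing) auto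
    also have "\<dots> = \<bar>2 ^ n * x $ i - 2 ^ n * y $ i\<bar>"
      by (simp flip: right_diff_distrib add: abs_mult)
    finally have "1 < \<bar>2 ^ n * x $ i - 2 ^ n * y $ i\<bar>" .
    moreover have "\<lfloor>2 ^ n * x $ i\<rfloor> = \<lfloor>2 ^ n * y $ i\<rfloor>"
      using eq by (simp add: grid_cell_def vec_eq_iff)
    ultimately show False by linarith
  qed
  then show ?thesis
    unfolding eventually_sequentially by blast
qed

lemma grid_cell_eventually_inj_on:
  assumes "finite X"
  shows "\<forall>\<^sub>F n in sequentially. inj_on (grid_cell n) X"
proof -
  have "\<forall>\<^sub>F n in sequentially. \<forall>x\<in>X. \<forall>y\<in>X. x \<noteq> y \<longrightarrow> grid_cell n x \<noteq> grid_cell n y"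
    using assms by (intro eventually_ball_finite ballI) (auto intro: grid_cell_eventually_neq)
  then show ?thesis
    by eventually_elim (auto simp: inj_on_def)
qed

lemma grid_cell_vimage_lebesgue:
  fixes k :: "int^'n::finite"
  shows "{x. grid_cell n x = k} \<in> sets lebesgue"
proof -
  have "{x::real^'n. grid_cell n x = k} = (\<Inter>i. {x. \<lfloor>2 ^ n * x $ i\<rfloor> = k $ i})"
    by (auto simp: grid_cell_def vec_eq_iff)
  also have "\<dots> \<in> sets borel"
    by measurable
  finally show ?thesis
    by (simp add: sets_completionI_sets)
qed

text \<open>One half of the area formula. Adding the image bounds over all cells of level n gives
  the same right-hand side for every n, so the estimate survives the limit by Fatou's lemma.\<close>

lemma nn_integral_card_vimage_le:
  fixes f :: "real^'n::{finite,wellorder} \<Rightarrow> real^'n::_"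
  assumes S: "S \<in> sets lebesgue"
    and deriv: "\<And>x. x \<in> S \<Longrightarrow> (f has_derivative f' x) (at x within S)"
    and int: "(\<lambda>x. \<bar>det (matrix (f' x))\<bar>) integrable_on S"
  shows "(\<integral>\<^sup>+w. of_nat (card {x \<in> S. f x = w}) \<partial>lebesgue)
     \<le> (\<integral>\<^sup>+x. ennreal \<bar>det (matrix (f' x))\<bar> * indicator S x \<partial>lebesgue)"
proof -
  \<comment> \<open>Integer vectors are countable, so \<open>to_nat\<close> numbers the cells and
    sums over cells run over all natural numbers; a number that belongs to no cell gives an empty
    piece.\<close>
  define D where "D n k = {x \<in> S. to_nat (grid_cell n x) = k}" for n k
  \<comment> \<open>This counts the pieces of level n whose image contains \<open>w\<close>; several
    preimages in one piece count once.\<close>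
  define N :: "nat \<Rightarrow> real^'n::{finite,wellorder} \<Rightarrow> ennreal" where "N n w = (\<Sum>k. indicator (f ` D n k) w)" for n w
  have D_sub: "D n k \<subseteq> S" for n k by (auto simp: D_def)
  have D_meas: "D n k \<in> sets lebesgue" for n k
  proof -
    have "D n k = S \<inter> (if k \<in> range (to_nat :: int^'n::{finite,wellorder} \<Rightarrow> nat)
                         then {x. grid_cell n x = from_nat k} else {})"
      by (auto simp: D_def)
    then show ?thesis
      using S grid_cell_vimage_lebesgue [of n "from_nat k :: int^'n::{finite,wellorder}"] by (auto intro: sets.Int)
  qed
  have D_int: "(\<lambda>x. \<bar>det (matrix (f' x))\<bar>) integrable_on D n k" for n k
  proof -
    have "(\<lambda>x. \<bar>det (matrix (f' x))\<bar>) absolutely_integrable_on S"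
      using int by (simp add: absolutely_integrable_on_iff_nonneg)
    then have "(\<lambda>x. \<bar>det (matrix (f' x))\<bar>) absolutely_integrable_on D n k"
      using D_meas D_sub by (rule set_integrable_subset)
    then show ?thesis
      by (rule set_lebesgue_integral_eq_integral)
  qed
  have D_deriv: "(f has_derivative f' x) (at x within D n k)" if "x \<in> D n k" for n k x
    using has_derivative_subset [OF deriv D_sub] that D_sub by blast
  note img = emeasure_differentiable_image_le [OF D_meas D_deriv D_int]
  have [measurable]: "f ` D n k \<in> sets lebesgue" for n k
    by (rule img(1))
  have detm: "(\<lambda>x. ennreal \<bar>det (matrix (f' x))\<bar> * indicator (D n k) x) \<in> borel_measurable lebesgue" for n k
  proof -
    have "(\<lambda>x. \<bar>det (matrix (f' x))\<bar>) \<in> borel_measurable (lebesgue_on (D n k))"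
      using borel_measurable_det_Jacobian [OF D_meas D_deriv] by simp
    then have "(\<lambda>x. \<bar>det (matrix (f' x))\<bar> * indicator (D n k) x) \<in> borel_measurable lebesgue"
      using D_meas by (simp add: borel_measurable_restrict_space_iff mult.commute)
    then have "(\<lambda>x. ennreal (\<bar>det (matrix (f' x))\<bar> * indicator (D n k) x)) \<in> borel_measurable lebesgue"
      by measurable
    then show ?thesis by (simp add: ennreal_mult' ennreal_indicator)
  qed
  have "(\<integral>\<^sup>+w. N n w \<partial>lebesgue)
          \<le> (\<integral>\<^sup>+x. ennreal \<bar>det (matrix (f' x))\<bar> * indicator S x \<partial>lebesgue)" for n
  proof -
    have "(\<integral>\<^sup>+w. N n w \<partial>lebesgue) = (\<Sum>k. emeasure lebesgue (f ` D n k))"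
      unfolding N_def by (simp add: nn_integral_suminf)
    also have "\<dots> \<le> (\<Sum>k. \<integral>\<^sup>+x. ennreal \<bar>det (matrix (f' x))\<bar> * indicator (D n k) x \<partial>lebesgue)"
      by (intro suminf_le img(2)) auto
    also have "\<dots> = (\<integral>\<^sup>+x. (\<Sum>k. ennreal \<bar>det (matrix (f' x))\<bar> * indicator (D n k) x) \<partial>lebesgue)"
      using detm by (rule nn_integral_suminf [symmetric])
    also have "\<dots> = (\<integral>\<^sup>+x. ennreal \<bar>det (matrix (f' x))\<bar> * indicator S x \<partial>lebesgue)"
    proof (rule nn_integral_cong)
      fix x
      have "(\<Sum>k. indicator (D n k) x :: ennreal) = indicator (\<Union>k. D n k) x"
        by (rule suminf_indicator) (auto simp: disjoint_family_on_def D_def)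
      moreover have "(\<Union>k. D n k) = S"
        by (auto simp: D_def)
      ultimately show "(\<Sum>k. ennreal \<bar>det (matrix (f' x))\<bar> * indicator (D n k) x)
                      = ennreal \<bar>det (matrix (f' x))\<bar> * indicator S x"
        by simp
    qed
    finally show ?thesis .
  qed
  note N_le = this
  have card_le: "of_nat (card {x \<in> S. f x = w}) \<le> liminf (\<lambda>n. N n w)" for w
  \<comment> \<open>An infinite fibre has \<open>card\<close> equal to 0 by convention, so only
    finite fibres need an argument.\<close>
  proof (cases "finite {x \<in> S. f x = w}")
    case True
    define X where "X = {x \<in> S. f x = w}"
    \<comment> \<open>Once the grid separates the points of the fibre, they lie in
      \<open>card X\<close> different pieces, each of which contributes 1 to
      \<open>N n w\<close>.\<close>
    have "\<forall>\<^sub>F n in sequentially. of_nat (card X) \<le> N n w"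
      using grid_cell_eventually_inj_on [OF True]
    proof eventually_elim
      case (elim n)
      define K where "K = (\<lambda>x. to_nat (grid_cell n x)) ` X"
      have "inj_on (\<lambda>x. to_nat (grid_cell n x)) X"
        using elim unfolding X_def by (simp add: inj_on_def)
      then have "of_nat (card X) = (\<Sum>k\<in>K. 1::ennreal)"
        by (simp add: K_def card_image)
      also have "\<dots> \<le> (\<Sum>k\<in>K. indicator (f ` D n k) w)"
        by (rule sum_mono) (auto simp: K_def X_def D_def indicator_def)
      also have "\<dots> \<le> N n w"
        unfolding N_def using True by (intro sum_le_suminf) (auto simp: K_def X_def)
      finally show ?case .
    qed
    then show ?thesis
      unfolding X_def by (intro Liminf_bounded)
  qed simp
  have "(\<integral>\<^sup>+w. of_nat (card {x \<in> S. f x = w}) \<partial>lebesgue) \<le> (\<integral>\<^sup>+w. liminf (\<lambda>n. N n w) \<partial>lebesgue)"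
    by (intro nn_integral_mono card_le)
  also have "\<dots> \<le> liminf (\<lambda>n. \<integral>\<^sup>+w. N n w \<partial>lebesgue)"
    unfolding N_def by (intro nn_integral_liminf) measurable
  also have "\<dots> \<le> (\<integral>\<^sup>+x. ennreal \<bar>det (matrix (f' x))\<bar> * indicator S x \<partial>lebesgue)"
    using N_le by (intro Liminf_le) auto
  finally show ?thesis .
qed

section \<open>Parseval and Rogosinski inequalities\<close>

text \<open>Orthogonality of the characters of the circle: for nonzero m the antiderivative takes
  the same value at both ends of the period.\<close>

lemma has_integral_cis_int_mult:
  "((\<lambda>t. cis (of_int m * t)) has_integral (if m = 0 then of_real (2 * pi) else 0)) {0..2 * pi}"
proof (cases "m = 0")
  case True
  then show ?thesis
    using has_integral_const_real [of "1::complex" 0 "2 * pi"] by (simp add: scaleR_conv_of_real)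
next
  case False
  have "((\<lambda>t. cis (of_int m * t)) has_integral
          cis (of_int m * (2 * pi)) / (\<i> * of_int m) - cis (of_int m * 0) / (\<i> * of_int m)) {0..2 * pi}"
  proof (rule fundamental_theorem_of_calculus)
    fix t :: real assume "t \<in> {0..2 * pi}"
    have "((\<lambda>z. exp (\<i> * (of_int m * z)) / (\<i> * of_int m)) has_field_derivative exp (\<i> * (of_int m * of_real t)))
            (at (of_real t))"
      using False by (auto intro!: derivative_eq_intros simp: mult_ac)
    then have "((\<lambda>t. exp (\<i> * (of_int m * of_real t)) / (\<i> * of_int m)) has_vector_derivative exp (\<i> * (of_int m * of_real t)))
            (at t within {0..2 * pi})"
      by (rule has_vector_derivative_real_field)
    then show "((\<lambda>t. cis (of_int m * t) / (\<i> * of_int m)) has_vector_derivative cis (of_int m * t))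
            (at t within {0..2 * pi})"
      by (simp add: cis_conv_exp)
  qed simp
  moreover have "cis (of_int m * (2 * pi)) = 1"
    using cis_multiple_2pi [of "of_int m"] by (simp add: mult.commute mult.left_commute)
  ultimately show ?thesis
    using False by simp
qed

text \<open>Parseval for polynomials: in the double sum for the squared modulus only the diagonal
  terms survive integration.\<close>

lemma has_integral_norm_sq_polynomial_circle:
  fixes a :: "nat \<Rightarrow> complex" and \<rho> :: real
  shows "((\<lambda>t. (norm (\<Sum>k<n. a k * rcis \<rho> t ^ k))\<^sup>2) has_integral
           2 * pi * (\<Sum>k<n. (norm (a k))\<^sup>2 * \<rho> ^ (2 * k))) {0..2 * pi}"
proof -
  have expand: "of_real ((norm (\<Sum>k<n. a k * rcis \<rho> t ^ k))\<^sup>2) =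
      (\<Sum>j<n. \<Sum>k<n. a j * cnj (a k) * of_real (\<rho> ^ (j + k)) * cis (of_int (int j - int k) * t))" for t
  proof -
    have "of_real ((norm (\<Sum>k<n. a k * rcis \<rho> t ^ k))\<^sup>2) =
       (\<Sum>k<n. a k * rcis \<rho> t ^ k) * cnj (\<Sum>k<n. a k * rcis \<rho> t ^ k)"
      by (simp only: complex_norm_square)
    also have "\<dots> = (\<Sum>j<n. \<Sum>k<n. a j * rcis \<rho> t ^ j * cnj (a k * rcis \<rho> t ^ k))"
      by (simp add: sum_product)
    also have "\<dots> = (\<Sum>j<n. \<Sum>k<n. a j * cnj (a k) * of_real (\<rho> ^ (j + k)) * cis (of_int (int j - int k) * t))"
    proof (intro sum.cong refl)
      fix j k
      have "cis (of_int (int j - int k) * t) = cis (real j * t) * cis (- (real k * t))"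
        by (simp add: cis_mult algebra_simps)
      also have "\<dots> = cis t ^ j * cis (- t) ^ k"
        by (simp add: Complex.DeMoivre)
      finally have "cis (of_int (int j - int k) * t) = cis t ^ j * cis (- t) ^ k" .
      then show "a j * rcis \<rho> t ^ j * cnj (a k * rcis \<rho> t ^ k) =
           a j * cnj (a k) * of_real (\<rho> ^ (j + k)) * cis (of_int (int j - int k) * t)"
        by (simp add: rcis_def power_mult_distrib power_add cis_cnj)
    qed
    finally show ?thesis .
  qed
  have "((\<lambda>t. (\<Sum>j<n. \<Sum>k<n. a j * cnj (a k) * of_real (\<rho> ^ (j + k)) * cis (of_int (int j - int k) * t)))
      has_integral (\<Sum>j<n. \<Sum>k<n. a j * cnj (a k) * of_real (\<rho> ^ (j + k)) *
          (if int j - int k = 0 then of_real (2 * pi) else 0))) {0..2 * pi}"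
    by (intro has_integral_sum finite_lessThan has_integral_mult_right has_integral_cis_int_mult)
  moreover have "(\<Sum>j<n. \<Sum>k<n. a j * cnj (a k) * of_real (\<rho> ^ (j + k)) *
          (if int j - int k = 0 then of_real (2 * pi) else 0)) =
       of_real (2 * pi * (\<Sum>k<n. (norm (a k))\<^sup>2 * \<rho> ^ (2 * k)))"
  proof -
    have "(\<Sum>k<n. a j * cnj (a k) * of_real (\<rho> ^ (j + k)) *
          (if int j - int k = 0 then of_real (2 * pi) else 0)) =
          of_real (2 * pi * ((norm (a j))\<^sup>2 * \<rho> ^ (2 * j)))" if "j < n" for j
    proof -
      have "(\<Sum>k<n. a j * cnj (a k) * of_real (\<rho> ^ (j + k)) *
          (if int j - int k = 0 then of_real (2 * pi) else 0)) =
          (\<Sum>k<n. if k = j then a j * cnj (a j) * of_real (\<rho> ^ (j + j)) * of_real (2 * pi) else 0)"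
        by (intro sum.cong) auto
      also have "\<dots> = a j * cnj (a j) * of_real (\<rho> ^ (j + j)) * of_real (2 * pi)"
        using that by (simp add: sum.delta)
      also have "a j * cnj (a j) = of_real ((norm (a j))\<^sup>2)"
        by (simp only: complex_norm_square)
      finally show ?thesis
        unfolding mult_2 [of j] by (simp only: of_real_mult mult_ac)
    qed
    then show ?thesis
      by (simp add: sum_distrib_left)
  qed
  ultimately have "((\<lambda>t. complex_of_real ((norm (\<Sum>k<n. a k * rcis \<rho> t ^ k))\<^sup>2)) has_integral
       of_real (2 * pi * (\<Sum>k<n. (norm (a k))\<^sup>2 * \<rho> ^ (2 * k)))) {0..2 * pi}"
    by (simp only: expand)
  from has_integral_Re [OF this] show ?thesis
    by simp
qed

text \<open>Dominated convergence extends the polynomial case to power series, since on the circle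
  the partial sums are bounded by the sum of the absolute values of the terms.\<close>

lemma parseval_circle:
  fixes a :: "nat \<Rightarrow> complex" and F :: "complex \<Rightarrow> complex" and \<rho> :: real
  assumes F: "\<And>z. norm z < 1 \<Longrightarrow> (\<lambda>k. a k * z ^ k) sums F z" and \<rho>: "0 \<le> \<rho>" "\<rho> < 1"
  obtains m where "(\<lambda>k. (norm (a k))\<^sup>2 * \<rho> ^ (2 * k)) sums m"
    "((\<lambda>t. (norm (F (rcis \<rho> t)))\<^sup>2) has_integral 2 * pi * m) {0..2 * pi}"
proof -
  define P where "P n t = (\<Sum>k<n. a k * rcis \<rho> t ^ k)" for n t
  \<comment> \<open>Absolute convergence at radius \<rho> follows from convergence at (1 + \<rho>) /
    2, a larger radius still inside the unit disk.\<close>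
  have summ: "summable (\<lambda>k. norm (a k * of_real \<rho> ^ k))"
  proof (rule powser_insidea)
    show "summable (\<lambda>k. a k * (of_real ((1 + \<rho>) / 2)) ^ k)"
      using F [of "of_real ((1 + \<rho>) / 2)"] \<rho> by (intro sums_summable) (auto simp del: of_real_add of_real_divide)
    show "norm (complex_of_real \<rho>) < norm (complex_of_real ((1 + \<rho>) / 2))"
      using \<rho> by (simp del: of_real_add of_real_divide)
  qed
  define C where "C = (\<Sum>k. norm (a k * of_real \<rho> ^ k))"
  have P_le: "norm (P n t) \<le> C" for n t
  proof -
    have "norm (P n t) \<le> (\<Sum>k<n. norm (a k * of_real \<rho> ^ k))"
      unfolding P_def using \<rho> by (intro sum_norm_le) (simp add: norm_mult norm_power)
    also have "\<dots> \<le> C"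
      unfolding C_def using summ by (intro sum_le_suminf) auto
    finally show ?thesis .
  qed
  have P_lim: "(\<lambda>n. P n t) \<longlonglongrightarrow> F (rcis \<rho> t)" for t
    unfolding P_def using F [of "rcis \<rho> t"] \<rho> by (simp add: sums_def)
  have P_int: "((\<lambda>t. (norm (P n t))\<^sup>2) has_integral 2 * pi * (\<Sum>k<n. (norm (a k))\<^sup>2 * \<rho> ^ (2 * k))) {0..2 * pi}" for n
    unfolding P_def by (rule has_integral_norm_sq_polynomial_circle)
  have dc: "(\<lambda>t. (norm (F (rcis \<rho> t)))\<^sup>2) integrable_on {0..2 * pi}"
    "(\<lambda>n. integral {0..2 * pi} (\<lambda>t. (norm (P n t))\<^sup>2)) \<longlonglongrightarrow> integral {0..2 * pi} (\<lambda>t. (norm (F (rcis \<rho> t)))\<^sup>2)"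
  proof -
    have 1: "(\<lambda>t. (norm (P n t))\<^sup>2) integrable_on {0..2 * pi}" for n
      using P_int by (rule has_integral_integrable)
    have 2: "(\<lambda>t::real. C\<^sup>2) integrable_on {0..2 * pi}"
      by (rule integrable_const_ivl)
    have 3: "norm ((norm (P n t))\<^sup>2) \<le> C\<^sup>2" for n t
      using P_le [of n t] by (simp add: power_mono)
    have 4: "(\<lambda>n. (norm (P n t))\<^sup>2) \<longlonglongrightarrow> (norm (F (rcis \<rho> t)))\<^sup>2" for t
      by (intro tendsto_intros P_lim)
    show "(\<lambda>t. (norm (F (rcis \<rho> t)))\<^sup>2) integrable_on {0..2 * pi}"
      by (rule dominated_convergence(1) [OF 1 2 3 4])
    show "(\<lambda>n. integral {0..2 * pi} (\<lambda>t. (norm (P n t))\<^sup>2)) \<longlonglongrightarrow> integral {0..2 * pi} (\<lambda>t. (norm (F (rcis \<rho> t)))\<^sup>2)"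
      by (rule dominated_convergence(2) [OF 1 2 3 4])
  qed
  define m where "m = integral {0..2 * pi} (\<lambda>t. (norm (F (rcis \<rho> t)))\<^sup>2) / (2 * pi)"
  show thesis
  proof
    show "((\<lambda>t. (norm (F (rcis \<rho> t)))\<^sup>2) has_integral 2 * pi * m) {0..2 * pi}"
      using dc(1) by (simp add: m_def has_integral_integral)
    have "(\<lambda>n. (2 * pi * (\<Sum>k<n. (norm (a k))\<^sup>2 * \<rho> ^ (2 * k))) / (2 * pi)) \<longlonglongrightarrow> m"
      unfolding m_def using dc(2) P_int [THEN integral_unique] by (intro tendsto_divide) auto
    then show "(\<lambda>k. (norm (a k))\<^sup>2 * \<rho> ^ (2 * k)) sums m"
      by (simp add: sums_def)
  qed
qed

text \<open>Multiplication by a function bounded by 1 does not increase the Hardy space norm: on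
  each circle |w p| \<le> |p|, Parseval applies to both sides, and the radius tends to 1. Here p is
  the polynomial with coefficients \<open>c\<close>, and the inner sums are the coefficients of w
  p.\<close>

lemma sum_norm_sq_mult_polynomial_le:
  fixes b c :: "nat \<Rightarrow> complex" and w :: "complex \<Rightarrow> complex"
  assumes w: "\<And>z. norm z < 1 \<Longrightarrow> (\<lambda>k. b k * z ^ k) sums w z"
    and w_le: "\<And>z. norm z < 1 \<Longrightarrow> norm (w z) \<le> 1"
    and c: "\<And>k. n \<le> k \<Longrightarrow> c k = 0"
  shows "(\<Sum>k<N. (norm (\<Sum>i\<le>k. b i * c (k - i)))\<^sup>2) \<le> (\<Sum>k<n. (norm (c k))\<^sup>2)"
proof -
  define d where "d k = (\<Sum>i\<le>k. b i * c (k - i))" for k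
  define p where "p z = (\<Sum>k<n. c k * z ^ k)" for z
  have wp: "(\<lambda>k. d k * z ^ k) sums (w z * p z)" if z: "norm z < 1" for z
  proof -
    obtain t where t: "norm z < t" "t < 1" using dense z by blast
    have 1: "summable (\<lambda>k. norm (b k * z ^ k))"
    proof (rule powser_insidea)
      show "summable (\<lambda>k. b k * of_real t ^ k)"
        using w [of "of_real t"] t norm_ge_zero [of z] by (intro sums_summable) (auto simp del: norm_ge_zero)
      show "norm z < norm (of_real t :: complex)"
        using t norm_ge_zero [of z] by (simp del: norm_ge_zero)
    qed
    have c_sums: "(\<lambda>k. c k * z ^ k) sums p z"
      unfolding p_def using c by (intro sums_finite) auto
    have 2: "summable (\<lambda>k. norm (c k * z ^ k))"
      using c by (intro summable_finite [of "{..<n}"]) auto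
    have "(\<lambda>k. \<Sum>i\<le>k. (b i * z ^ i) * (c (k - i) * z ^ (k - i))) sums
            ((\<Sum>k. b k * z ^ k) * (\<Sum>k. c k * z ^ k))"
      using 1 2 by (rule Cauchy_product_sums)
    moreover have "(\<Sum>i\<le>k. (b i * z ^ i) * (c (k - i) * z ^ (k - i))) = d k * z ^ k" for k
      unfolding d_def sum_distrib_right
      by (intro sum.cong) (auto simp: mult_ac simp flip: power_add)
    ultimately show ?thesis
      using sums_unique [OF w [OF z]] sums_unique [OF c_sums] by simp
  qed
  have below: "(\<Sum>k<N. (norm (d k))\<^sup>2 * \<rho> ^ (2 * k)) \<le> (\<Sum>k<n. (norm (c k))\<^sup>2)"
    if \<rho>: "0 \<le> \<rho>" "\<rho> < 1" for \<rho> :: real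
  proof -
    obtain m where m: "(\<lambda>k. (norm (d k))\<^sup>2 * \<rho> ^ (2 * k)) sums m"
      and m_int: "((\<lambda>t. (norm (w (rcis \<rho> t) * p (rcis \<rho> t)))\<^sup>2) has_integral 2 * pi * m) {0..2 * pi}"
      using parseval_circle [OF wp \<rho>] by blast
    have p_int: "((\<lambda>t. (norm (p (rcis \<rho> t)))\<^sup>2) has_integral
           2 * pi * (\<Sum>k<n. (norm (c k))\<^sup>2 * \<rho> ^ (2 * k))) {0..2 * pi}"
      unfolding p_def by (rule has_integral_norm_sq_polynomial_circle)
    have "(norm (w (rcis \<rho> t) * p (rcis \<rho> t)))\<^sup>2 \<le> (norm (p (rcis \<rho> t)))\<^sup>2" for t
    proof -
      have "norm (w (rcis \<rho> t)) * norm (p (rcis \<rho> t)) \<le> 1 * norm (p (rcis \<rho> t))"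
        using w_le [of "rcis \<rho> t"] \<rho> by (intro mult_right_mono) auto
      then show ?thesis
        by (intro power_mono) (auto simp: norm_mult)
    qed
    then have "2 * pi * m \<le> 2 * pi * (\<Sum>k<n. (norm (c k))\<^sup>2 * \<rho> ^ (2 * k))"
      using has_integral_le [OF m_int p_int] by blast
    then have "m \<le> (\<Sum>k<n. (norm (c k))\<^sup>2 * \<rho> ^ (2 * k))"
      by simp
    also have "\<dots> \<le> (\<Sum>k<n. (norm (c k))\<^sup>2)"
      using \<rho> by (intro sum_mono mult_left_le power_le_one) auto
    finally have "m \<le> (\<Sum>k<n. (norm (c k))\<^sup>2)" .
    moreover have "(\<Sum>k<N. (norm (d k))\<^sup>2 * \<rho> ^ (2 * k)) \<le> m"
      using m \<rho> unfolding sums_iff by (auto intro!: sum_le_suminf)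
    ultimately show ?thesis by simp
  qed
  \<comment> \<open>Only finitely many terms are kept on the left, so the passage to radius 1 is
    plain continuity.\<close>
  have "((\<lambda>\<rho>. \<Sum>k<N. (norm (d k))\<^sup>2 * \<rho> ^ (2 * k)) \<longlongrightarrow> (\<Sum>k<N. (norm (d k))\<^sup>2 * 1 ^ (2 * k))) (at_left (1::real))"
    by (intro tendsto_intros)
  moreover have "\<forall>\<^sub>F \<rho> in at_left (1::real). (\<Sum>k<N. (norm (d k))\<^sup>2 * \<rho> ^ (2 * k)) \<le> (\<Sum>k<n. (norm (c k))\<^sup>2)"
    unfolding eventually_at_left_field by (rule exI [of _ 0]) (use below in auto)
  ultimately have "(\<Sum>k<N. (norm (d k))\<^sup>2 * 1 ^ (2 * k)) \<le> (\<Sum>k<n. (norm (c k))\<^sup>2)"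
    by (rule tendsto_upperbound) simp
  then show ?thesis
    by (simp add: d_def)
qed

section \<open>Coefficients of functions bounded by one\<close>

lemma sums_fps_expansion:
  assumes "f holomorphic_on ball 0 1" "norm z < 1"
  shows "(\<lambda>k. fps_nth (fps_expansion f 0) k * z ^ k) sums f z"
  using holomorphic_power_series [OF assms(1), of z] assms(2) by (simp add: fps_expansion_def)

text \<open>The difference of the squared sides factors as
  \<open>(1 - (norm a)\<^sup>2) * (1 - (norm w)\<^sup>2)\<close>. This is what keeps Moebius
  quotients of bounded functions bounded by 1.\<close>

lemma norm_diff_le_norm_one_minus_cnj_mult:
  fixes a w :: complex
  assumes "norm a \<le> 1" "norm w \<le> 1"
  shows "norm (a - w) \<le> norm (1 - cnj a * w)"
proof -
  have "(norm (1 - cnj a * w))\<^sup>2 - (norm (a - w))\<^sup>2 = (1 - (norm a)\<^sup>2) * (1 - (norm w)\<^sup>2)"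
    unfolding cmod_power2 by (simp add: power2_eq_square algebra_simps)
  moreover have "0 \<le> (1 - (norm a)\<^sup>2) * (1 - (norm w)\<^sup>2)"
    using assms by (intro mult_nonneg_nonneg) (auto simp: power_le_one)
  ultimately have "(norm (a - w))\<^sup>2 \<le> (norm (1 - cnj a * w))\<^sup>2"
    by linarith
  then show ?thesis
    by (rule power2_le_imp_le) simp
qed

text \<open>The multiplier inequality for the constant polynomial 1. It serves the case |a_0| = 1,
  where the Moebius quotient degenerates.\<close>

lemma sum_norm_sq_coeff_le_1:
  assumes f: "f holomorphic_on ball 0 1" and f_le: "\<And>z. norm z < 1 \<Longrightarrow> norm (f z) \<le> 1"
  shows "(\<Sum>k<N. (norm (fps_nth (fps_expansion f 0) k))\<^sup>2) \<le> 1"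
proof -
  define c :: "nat \<Rightarrow> complex" where "c k = of_bool (k = 0)" for k
  have "(\<Sum>i\<le>k. fps_nth (fps_expansion f 0) i * c (k - i)) = fps_nth (fps_expansion f 0) k" for k
  proof -
    have "(\<Sum>i\<le>k. fps_nth (fps_expansion f 0) i * c (k - i)) =
          (\<Sum>i\<le>k. if i = k then fps_nth (fps_expansion f 0) k else 0)"
      by (intro sum.cong) (auto simp: c_def)
    then show ?thesis by simp
  qed
  with sum_norm_sq_mult_polynomial_le [OF sums_fps_expansion [OF f] f_le, of 1 c N]
  show ?thesis by (simp add: c_def)
qed

text \<open>With \<open>w = (a\<^sub>0 - f) / (1 - cnj a\<^sub>0 f)\<close> one has
  \<open>a\<^sub>0 - f = w (1 - cnj a\<^sub>0 f)\<close>, and since \<open>w 0 = 0\<close> the first \<open>n + 1\<close> coefficients of the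
  left-hand side involve only the first \<open>n\<close> coefficients of the second factor.\<close>

lemma sum_norm_sq_coeff_Suc_step:
  assumes f: "f holomorphic_on ball 0 1" and f_le: "\<And>z. norm z < 1 \<Longrightarrow> norm (f z) \<le> 1"
  defines "a \<equiv> fps_nth (fps_expansion f 0)"
  assumes a0: "norm (a 0) < 1"
  shows "(\<Sum>k<Suc n. (norm (a (Suc k)))\<^sup>2)
     \<le> (1 - (norm (a 0))\<^sup>2)\<^sup>2 + (norm (a 0))\<^sup>2 * (\<Sum>k<n. (norm (a (Suc k)))\<^sup>2)"
proof -
  define h where "h z = 1 - cnj (a 0) * f z" for z
  define w where "w z = (a 0 - f z) / h z" for z
  have h_nz: "h z \<noteq> 0" if "norm z < 1" for z
  proof
    assume "h z = 0"
    then have "norm (cnj (a 0) * f z) = 1" by (simp add: h_def)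
    moreover have "norm (a 0) * norm (f z) \<le> norm (a 0) * 1"
      using f_le [OF that] by (intro mult_left_mono) auto
    ultimately show False using a0 by (simp add: norm_mult)
  qed
  have h_holo: "h holomorphic_on ball 0 1"
    unfolding h_def by (intro holomorphic_intros f)
  have w_holo: "w holomorphic_on ball 0 1"
    unfolding w_def using h_nz by (intro holomorphic_intros f h_holo) auto
  have w_le: "norm (w z) \<le> 1" if "norm z < 1" for z
    using norm_diff_le_norm_one_minus_cnj_mult [of "a 0" "f z"] a0 f_le [OF that] h_nz [OF that]
    by (simp add: w_def h_def norm_divide)
  have f_exp: "f has_fps_expansion fps_expansion f 0"
    using f by (intro has_fps_expansion_fps_expansion [of "ball 0 1"]) auto
  define H where "H = 1 - fps_const (cnj (a 0)) * fps_expansion f 0"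
  have h_exp: "h has_fps_expansion H"
    unfolding h_def H_def by (intro fps_expansion_intros f_exp)
  have w_exp: "w has_fps_expansion fps_expansion w 0"
    using w_holo by (intro has_fps_expansion_fps_expansion [of "ball 0 1"]) auto
  have "(\<lambda>z. w z * h z) has_fps_expansion fps_expansion w 0 * H"
    by (intro fps_expansion_intros w_exp h_exp)
  moreover have "\<forall>\<^sub>F z in nhds 0. w z * h z = a 0 - f z"
  proof (rule eventually_nhds_in_open [of "ball 0 1", THEN eventually_mono])
    show "w z * h z = a 0 - f z" if "z \<in> ball 0 1" for z
      using h_nz [of z] that by (simp add: w_def)
  qed auto
  ultimately have "(\<lambda>z. a 0 - f z) has_fps_expansion fps_expansion w 0 * H"
    by (simp only: has_fps_expansion_cong [OF _ refl])
  moreover have "(\<lambda>z. a 0 - f z) has_fps_expansion fps_const (a 0) - fps_expansion f 0"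
    by (intro fps_expansion_intros f_exp)
  ultimately have eq: "fps_expansion w 0 * H = fps_const (a 0) - fps_expansion f 0"
    by (rule fps_expansion_unique_complex)
  define b where "b = fps_nth (fps_expansion w 0)"
  have w0: "b 0 = 0"
    using h_nz [of 0] has_fps_expansion_imp_0_eq_fps_nth_0 [OF f_exp]
    by (simp add: b_def fps_expansion_def w_def a_def)
  \<comment> \<open>Truncation at degree n turns the second factor into a polynomial. In the
    convolutions up to index \<open>Suc n\<close> the only discarded coefficient would be multiplied
    by \<open>b 0\<close>, which is 0.\<close>
  define c where "c k = (if k < Suc n then fps_nth H k else 0)" for k
  have c0: "c 0 = of_real (1 - (norm (a 0))\<^sup>2)"
    by (simp only: of_real_diff complex_norm_square) (simp add: c_def H_def a_def mult.commute)
  have cS: "c (Suc k) = - cnj (a 0) * a (Suc k)" if "k < n" for k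
    using that by (simp add: c_def H_def a_def)
  have conv: "(\<Sum>i\<le>k. b i * c (k - i)) = (if k = 0 then 0 else - a k)" if "k \<le> Suc n" for k
  proof -
    have "(\<Sum>i\<le>k. b i * c (k - i)) = (\<Sum>i\<le>k. b i * fps_nth H (k - i))"
    proof (intro sum.cong refl)
      fix i assume "i \<in> {..k}"
      show "b i * c (k - i) = b i * fps_nth H (k - i)"
        using that w0 by (cases "i = 0") (auto simp: c_def)
    qed
    also have "\<dots> = fps_nth (fps_expansion w 0 * H) k"
      by (simp add: fps_mult_nth b_def atLeast0AtMost)
    also have "\<dots> = (if k = 0 then 0 else - a k)"
      unfolding eq by (simp add: a_def)
    finally show ?thesis .
  qed
  have "(\<Sum>k<Suc n. (norm (a (Suc k)))\<^sup>2) = (\<Sum>k<Suc n. (norm (\<Sum>i\<le>Suc k. b i * c (Suc k - i)))\<^sup>2)"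
    by (intro sum.cong refl, subst conv) auto
  also have "\<dots> = (\<Sum>k<Suc (Suc n). (norm (\<Sum>i\<le>k. b i * c (k - i)))\<^sup>2)"
    using conv [of 0] unfolding sum.lessThan_Suc_shift [of _ "Suc n"] by simp
  also have "\<dots> \<le> (\<Sum>k<Suc n. (norm (c k))\<^sup>2)"
    using sums_fps_expansion [OF w_holo] w_le unfolding b_def
    by (intro sum_norm_sq_mult_polynomial_le) (auto simp: c_def)
  also have "\<dots> = (norm (c 0))\<^sup>2 + (\<Sum>k<n. (norm (c (Suc k)))\<^sup>2)"
    by (rule sum.lessThan_Suc_shift)
  also have "(norm (c 0))\<^sup>2 = (1 - (norm (a 0))\<^sup>2)\<^sup>2"
    by (simp only: c0 norm_of_real power2_abs)
  also have "(\<Sum>k<n. (norm (c (Suc k)))\<^sup>2) = (norm (a 0))\<^sup>2 * (\<Sum>k<n. (norm (a (Suc k)))\<^sup>2)"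
    by (simp add: cS norm_mult power_mult_distrib sum_distrib_left)
  finally show ?thesis .
qed

text \<open>The right-hand side satisfies the recursion of \<open>sum_norm_sq_coeff_Suc_step\<close>
  with equality; its terms are the squared coefficients of the Moebius map with parameter |a_0|. If
  |a_0| is not below 1, the total sum of squares being at most 1 forces all later coefficients to
  vanish.\<close>

lemma sum_norm_sq_coeff_Suc_le:
  assumes f: "f holomorphic_on ball 0 1" and f_le: "\<And>z. norm z < 1 \<Longrightarrow> norm (f z) \<le> 1"
  defines "a \<equiv> fps_nth (fps_expansion f 0)"
  shows "(\<Sum>k<n. (norm (a (Suc k)))\<^sup>2) \<le> (\<Sum>k<n. ((1 - (norm (a 0))\<^sup>2) * norm (a 0) ^ k)\<^sup>2)"
proof (cases "norm (a 0) < 1")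
  case True
  show ?thesis
  proof (induction n)
    case (Suc n)
    have "(\<Sum>k<Suc n. (norm (a (Suc k)))\<^sup>2)
     \<le> (1 - (norm (a 0))\<^sup>2)\<^sup>2 + (norm (a 0))\<^sup>2 * (\<Sum>k<n. (norm (a (Suc k)))\<^sup>2)"
      using sum_norm_sq_coeff_Suc_step [OF f f_le] True unfolding a_def by blast
    also have "\<dots> \<le> (1 - (norm (a 0))\<^sup>2)\<^sup>2
        + (norm (a 0))\<^sup>2 * (\<Sum>k<n. ((1 - (norm (a 0))\<^sup>2) * norm (a 0) ^ k)\<^sup>2)"
      using Suc.IH by (intro add_left_mono mult_left_mono) auto
    also have "\<dots> = (\<Sum>k<Suc n. ((1 - (norm (a 0))\<^sup>2) * norm (a 0) ^ k)\<^sup>2)"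
      by (subst sum.lessThan_Suc_shift) (simp add: sum_distrib_left power_mult_distrib mult_ac)
    finally show ?case .
  qed simp
next
  case False
  have "(\<Sum>k<Suc n. (norm (a k))\<^sup>2) \<le> 1"
    unfolding a_def by (rule sum_norm_sq_coeff_le_1 [OF f]) (fact f_le)
  then have "(norm (a 0))\<^sup>2 + (\<Sum>k<n. (norm (a (Suc k)))\<^sup>2) \<le> 1"
    unfolding sum.lessThan_Suc_shift .
  moreover have "1 \<le> (norm (a 0))\<^sup>2"
    using False by (simp add: one_le_power)
  ultimately have "(\<Sum>k<n. (norm (a (Suc k)))\<^sup>2) \<le> 0"
    by linarith
  also have "0 \<le> (\<Sum>k<n. ((1 - (norm (a 0))\<^sup>2) * norm (a 0) ^ k)\<^sup>2)"
    by (intro sum_nonneg) auto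
  finally show ?thesis .
qed

section \<open>Weighted coefficient sums\<close>

text \<open>Summation by parts: a weighted sum is a combination of partial sums whose coefficients
  are the decrements of the weights and the last weight, all nonnegative.\<close>

lemma sum_weighted_le:
  fixes u x y :: "nat \<Rightarrow> real"
  assumes u: "decseq u" "\<And>k. 0 \<le> u k" and le: "\<And>n. (\<Sum>k<n. x k) \<le> (\<Sum>k<n. y k)"
  shows "(\<Sum>k<n. u k * x k) \<le> (\<Sum>k<n. u k * y k)"
proof -
  define D where "D n = (\<Sum>k<n. y k - x k)" for n
  have D: "0 \<le> D n" for n
    using le [of n] by (simp add: D_def sum_subtractf)
  \<comment> \<open>The boundary term makes the induction go through; it is nonnegative and dropped
    afterwards.\<close>
  have "u n * D n \<le> (\<Sum>k<n. u k * (y k - x k))"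
  proof (induction n)
    case (Suc n)
    have "u (Suc n) * D (Suc n) \<le> u n * D (Suc n)"
      using decseq_SucD [OF u(1)] D by (intro mult_right_mono)
    also have "\<dots> = u n * D n + u n * (y n - x n)"
      by (simp add: D_def algebra_simps)
    also have "\<dots> \<le> (\<Sum>k<Suc n. u k * (y k - x k))"
      using Suc.IH by simp
    finally show ?case .
  qed (simp add: D_def)
  moreover have "0 \<le> u n * D n"
    using u(2) D by simp
  ultimately show ?thesis
    by (simp add: right_diff_distrib sum_subtractf)
qed

lemma sum_geometric_le:
  fixes q :: real
  assumes "0 \<le> q" "q < 1"
  shows "(\<Sum>k<n. q ^ k) \<le> 1 / (1 - q)"
  using geometric_sums [of q] assms sum_le_suminf [of "\<lambda>k. q ^ k" "{..<n}"]
  by (auto simp: sums_iff)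

text \<open>The weights \<open>k * 9^(-k)\<close> decrease from k = 1 on, so the sum is at most the
  one for the Moebius coefficients. That one is a differentiated geometric series with ratio |a_0|^2
  / 9.\<close>

lemma area_coeff_sum_le:
  assumes f: "f holomorphic_on ball 0 1" and f_le: "\<And>z. norm z < 1 \<Longrightarrow> norm (f z) \<le> 1"
  defines "a \<equiv> fps_nth (fps_expansion f 0)"
  shows "(\<Sum>k<n. real (Suc k) * (norm (a (Suc k)))\<^sup>2 * (1 / 3) ^ (2 * Suc k))
     \<le> 9 * (1 - (norm (a 0))\<^sup>2)\<^sup>2 / (9 - (norm (a 0))\<^sup>2)\<^sup>2"
proof -
  define \<alpha> where "\<alpha> = norm (a 0)"
  define q where "q = \<alpha>\<^sup>2 / 9"
  have \<alpha>: "0 \<le> \<alpha>" "\<alpha> \<le> 1"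
    using f_le [of 0] by (auto simp: \<alpha>_def a_def fps_expansion_def)
  have q: "0 \<le> q" "q < 1"
    using power_le_one [OF \<alpha>, of 2] by (auto simp: q_def)
  define u :: "nat \<Rightarrow> real" where "u k = real (Suc k) * (1 / 9) ^ Suc k" for k
  have u: "decseq u" "0 \<le> u k" for k
    by (rule decseq_SucI) (simp_all add: u_def field_simps)
  then have "(\<Sum>k<n. u k * (norm (a (Suc k)))\<^sup>2) \<le> (\<Sum>k<n. u k * ((1 - \<alpha>\<^sup>2) * \<alpha> ^ k)\<^sup>2)"
    using sum_norm_sq_coeff_Suc_le [OF f f_le]
    unfolding a_def \<alpha>_def by (intro sum_weighted_le)
  also have "\<dots> = (1 - \<alpha>\<^sup>2)\<^sup>2 / 9 * (\<Sum>k<n. real (Suc k) * q ^ k)"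
    unfolding sum_distrib_left
  proof (intro sum.cong refl)
    fix k
    have "q ^ k = (\<alpha> ^ k)\<^sup>2 / 9 ^ k"
      by (simp add: q_def power_divide mult.commute flip: power_mult)
    then show "u k * ((1 - \<alpha>\<^sup>2) * \<alpha> ^ k)\<^sup>2 = (1 - \<alpha>\<^sup>2)\<^sup>2 / 9 * (real (Suc k) * q ^ k)"
      by (simp add: u_def power_mult_distrib power_one_over)
  qed
  also have "\<dots> \<le> (1 - \<alpha>\<^sup>2)\<^sup>2 / 9 * (1 / (1 - q)\<^sup>2)"
    using geometric_deriv_sums [of q] q sum_le_suminf [of "\<lambda>k. real (Suc k) * q ^ k" "{..<n}"]
    by (intro mult_left_mono) (auto simp: sums_iff)
  also have "\<dots> = 9 * (1 - \<alpha>\<^sup>2)\<^sup>2 / (9 - \<alpha>\<^sup>2)\<^sup>2"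
  proof -
    have "1 - q = (9 - \<alpha>\<^sup>2) / 9" by (simp add: q_def field_simps)
    then show ?thesis by (simp only: power_divide) simp
  qed
  also have "(\<Sum>k<n. u k * (norm (a (Suc k)))\<^sup>2) =
     (\<Sum>k<n. real (Suc k) * (norm (a (Suc k)))\<^sup>2 * (1 / 3) ^ (2 * Suc k))"
    unfolding power_mult by (intro sum.cong) (auto simp: u_def power2_eq_square)
  finally show ?thesis unfolding \<alpha>_def .
qed

text \<open>Cauchy-Schwarz after splitting each term into \<open>sqrt q ^ k * x k\<close> and
  \<open>(1 / (3 * sqrt q)) ^ k / 3\<close>. The weight \<open>q\<close> is left free, to be chosen
  according to |a_0|.\<close>

lemma coeff_sum_le_sqrt:
  fixes q C D :: real
  assumes q: "0 < q" and C: "(\<Sum>k<n. q ^ k * (x k)\<^sup>2) \<le> C" and D: "(\<Sum>k<n. (1 / (9 * q)) ^ k) \<le> D"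
  shows "(\<Sum>k<n. x k * (1 / 3) ^ Suc k) \<le> sqrt (C * D / 9)"
proof (rule real_le_rsqrt)
  have pos: "0 < sqrt q" using q by simp
  have "(\<Sum>k<n. x k * (1 / 3) ^ Suc k) = (\<Sum>k<n. (sqrt q ^ k * x k) * ((1 / (3 * sqrt q)) ^ k / 3))"
    using pos by (intro sum.cong) (auto simp: power_mult_distrib power_divide)
  then have "(\<Sum>k<n. x k * (1 / 3) ^ Suc k)\<^sup>2
      \<le> (\<Sum>k<n. (sqrt q ^ k * x k)\<^sup>2) * (\<Sum>k<n. ((1 / (3 * sqrt q)) ^ k / 3)\<^sup>2)"
    by (simp only: Cauchy_Schwarz_ineq_sum)
  also have "(\<Sum>k<n. (sqrt q ^ k * x k)\<^sup>2) = (\<Sum>k<n. q ^ k * (x k)\<^sup>2)"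
  proof (intro sum.cong refl)
    fix k
    have "(sqrt q ^ k)\<^sup>2 = ((sqrt q)\<^sup>2) ^ k"
      by (simp only: mult.commute flip: power_mult)
    then show "(sqrt q ^ k * x k)\<^sup>2 = q ^ k * (x k)\<^sup>2"
      using q by (simp add: power_mult_distrib)
  qed
  also have "(\<Sum>k<n. ((1 / (3 * sqrt q)) ^ k / 3)\<^sup>2) = (\<Sum>k<n. (1 / (9 * q)) ^ k) / 9"
    unfolding sum_divide_distrib
  proof (intro sum.cong refl)
    fix k
    have "((1 / (3 * sqrt q)) ^ k)\<^sup>2 = ((1 / (3 * sqrt q))\<^sup>2) ^ k"
      by (simp only: mult.commute flip: power_mult)
    also have "(1 / (3 * sqrt q))\<^sup>2 = 1 / (9 * q)"
      using q by (simp add: power_divide power_mult_distrib)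
    finally show "((1 / (3 * sqrt q)) ^ k / 3)\<^sup>2 = (1 / (9 * q)) ^ k / 9"
      by (simp add: power_divide)
  qed
  also have "(\<Sum>k<n. q ^ k * (x k)\<^sup>2) * ((\<Sum>k<n. (1 / (9 * q)) ^ k) / 9) \<le> C * (D / 9)"
    using q by (intro mult_mono C divide_right_mono D order.trans [OF _ C] sum_nonneg) (auto intro: sum_nonneg)
  finally show "(\<Sum>k<n. x k * (1 / 3) ^ Suc k)\<^sup>2 \<le> C * D / 9" by simp
qed

lemma coeff_sum_le_large:
  assumes f: "f holomorphic_on ball 0 1" and f_le: "\<And>z. norm z < 1 \<Longrightarrow> norm (f z) \<le> 1"
  defines "a \<equiv> fps_nth (fps_expansion f 0)"
  assumes a0: "1 / 3 \<le> norm (a 0)"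
  shows "(\<Sum>k<n. norm (a (Suc k)) * (1 / 3) ^ Suc k) \<le> (1 - (norm (a 0))\<^sup>2) / (3 - norm (a 0))"
proof -
  define \<alpha> where "\<alpha> = norm (a 0)"
  have \<alpha>: "1 / 3 \<le> \<alpha>" "\<alpha> \<le> 1"
    using f_le [of 0] a0 by (auto simp: \<alpha>_def a_def fps_expansion_def)
  \<comment> \<open>With this \<open>q\<close> both Cauchy-Schwarz factors are proportional for the
    Moebius coefficients, so nothing is lost. The assumption \<alpha> \<ge> 1/3 gives q \<le> 1,
    which makes the weights \<open>q ^ k\<close> decreasing.\<close>
  define q where "q = 1 / (3 * \<alpha>)"
  have q: "0 < q" "q \<le> 1" "1 / (9 * q) = \<alpha> / 3"
    using \<alpha> by (auto simp: q_def field_simps)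
  have geo: "(\<Sum>k<n. (\<alpha> / 3) ^ k) \<le> 1 / (1 - \<alpha> / 3)"
    using \<alpha> by (intro sum_geometric_le) auto
  have "decseq (\<lambda>k. q ^ k)"
    using q by (intro decseq_SucI) (auto intro!: mult_left_le_one_le)
  then have "(\<Sum>k<n. q ^ k * (norm (a (Suc k)))\<^sup>2) \<le> (\<Sum>k<n. q ^ k * ((1 - \<alpha>\<^sup>2) * \<alpha> ^ k)\<^sup>2)"
    using sum_norm_sq_coeff_Suc_le [OF f f_le] q
    unfolding a_def \<alpha>_def by (intro sum_weighted_le) auto
  also have "\<dots> = (1 - \<alpha>\<^sup>2)\<^sup>2 * (\<Sum>k<n. (\<alpha> / 3) ^ k)"
    unfolding sum_distrib_left
  proof (intro sum.cong refl)
    fix k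
    have "q * \<alpha>\<^sup>2 = \<alpha> / 3" using \<alpha> by (simp add: q_def power2_eq_square)
    then have "q ^ k * (\<alpha> ^ k)\<^sup>2 = (\<alpha> / 3) ^ k"
      by (metis power_mult_distrib power_commutes power_mult mult.commute)
    then show "q ^ k * ((1 - \<alpha>\<^sup>2) * \<alpha> ^ k)\<^sup>2 = (1 - \<alpha>\<^sup>2)\<^sup>2 * (\<alpha> / 3) ^ k"
      by (simp add: power_mult_distrib)
  qed
  also have "\<dots> \<le> (1 - \<alpha>\<^sup>2)\<^sup>2 * (1 / (1 - \<alpha> / 3))"
    using geo by (intro mult_left_mono) auto
  finally have C: "(\<Sum>k<n. q ^ k * (norm (a (Suc k)))\<^sup>2) \<le> (1 - \<alpha>\<^sup>2)\<^sup>2 * (1 / (1 - \<alpha> / 3))" .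
  have "(\<Sum>k<n. norm (a (Suc k)) * (1 / 3) ^ Suc k)
     \<le> sqrt ((1 - \<alpha>\<^sup>2)\<^sup>2 * (1 / (1 - \<alpha> / 3)) * (1 / (1 - \<alpha> / 3)) / 9)"
    using geo by (intro coeff_sum_le_sqrt [OF q(1) C]) (simp only: q(3))
  also have "(1 - \<alpha>\<^sup>2)\<^sup>2 * (1 / (1 - \<alpha> / 3)) * (1 / (1 - \<alpha> / 3)) / 9 = ((1 - \<alpha>\<^sup>2) / (3 - \<alpha>))\<^sup>2"
  proof -
    have "1 - \<alpha> / 3 = (3 - \<alpha>) / 3" by simp
    then show ?thesis by (simp only: power_divide) (simp add: power2_eq_square)
  qed
  also have "sqrt \<dots> = (1 - \<alpha>\<^sup>2) / (3 - \<alpha>)"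
    using \<alpha> by (simp add: power_le_one)
  finally show ?thesis unfolding \<alpha>_def .
qed

text \<open>Meant for |a_0| < 1/3, where the weights of \<open>coeff_sum_le_large\<close> would
  increase; Cauchy-Schwarz is used with q = 1 instead. At |a_0| = 1/3 both bounds equal 1/3.\<close>

lemma coeff_sum_le_small:
  assumes f: "f holomorphic_on ball 0 1" and f_le: "\<And>z. norm z < 1 \<Longrightarrow> norm (f z) \<le> 1"
  defines "a \<equiv> fps_nth (fps_expansion f 0)"
  assumes a0: "norm (a 0) < 1"
  shows "(\<Sum>k<n. norm (a (Suc k)) * (1 / 3) ^ Suc k) \<le> sqrt ((1 - (norm (a 0))\<^sup>2) / 8)"
proof -
  define \<alpha> where "\<alpha> = norm (a 0)"
  have \<alpha>: "0 \<le> \<alpha>" "\<alpha> < 1" "\<alpha>\<^sup>2 < 1"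
    using a0 by (auto simp: \<alpha>_def power_less_one_iff)
  have "(\<Sum>k<n. (norm (a (Suc k)))\<^sup>2) \<le> (\<Sum>k<n. ((1 - \<alpha>\<^sup>2) * \<alpha> ^ k)\<^sup>2)"
    using sum_norm_sq_coeff_Suc_le [OF f f_le] unfolding a_def \<alpha>_def .
  also have "\<dots> = (1 - \<alpha>\<^sup>2)\<^sup>2 * (\<Sum>k<n. (\<alpha>\<^sup>2) ^ k)"
    unfolding sum_distrib_left power_mult_distrib power_even_eq [symmetric]
    by (simp add: mult.commute flip: power_mult)
  also have "\<dots> \<le> (1 - \<alpha>\<^sup>2)\<^sup>2 * (1 / (1 - \<alpha>\<^sup>2))"
    using \<alpha> by (intro mult_left_mono sum_geometric_le) auto
  also have "\<dots> = 1 - \<alpha>\<^sup>2"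
    using \<alpha> by (simp add: power2_eq_square)
  finally have C: "(\<Sum>k<n. 1 ^ k * (norm (a (Suc k)))\<^sup>2) \<le> 1 - \<alpha>\<^sup>2" by simp
  have "(\<Sum>k<n. (1 / (9 * 1)) ^ k) \<le> (9 / 8 :: real)"
    using sum_geometric_le [of "1 / 9" n] by simp
  from coeff_sum_le_sqrt [OF zero_less_one C this]
  have "(\<Sum>k<n. norm (a (Suc k)) * (1 / 3) ^ Suc k) \<le> sqrt ((1 - \<alpha>\<^sup>2) * (9 / 8) / 9)" .
  also have "(1 - \<alpha>\<^sup>2) * (9 / 8) / 9 = (1 - \<alpha>\<^sup>2) / 8"
    by simp
  finally show ?thesis
    unfolding \<alpha>_def .
qed

section \<open>Image area of a holomorphic function\<close>

text \<open>The nonnegative integral is a supremum over simple functions below the integrand, so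
  this direction holds for arbitrary \<open>f\<close>. It transports the preimage count, whose
  measurability is left open.\<close>

lemma nn_integral_distr_le:
  assumes T: "T \<in> measurable N N'"
  shows "integral\<^sup>N (distr N N' T) f \<le> (\<integral>\<^sup>+x. f (T x) \<partial>N)"
  unfolding nn_integral_def [of "distr N N' T" f]
proof (rule SUP_least)
  fix g assume "g \<in> {g. simple_function (distr N N' T) g \<and> g \<le> f}"
  then have g: "simple_function (distr N N' T) g" "g \<le> f" by auto
  have "integral\<^sup>S (distr N N' T) g = integral\<^sup>N (distr N N' T) g"
    using g(1) by (rule nn_integral_eq_simple_integral [symmetric])
  also have "\<dots> = (\<integral>\<^sup>+x. g (T x) \<partial>N)"
    using borel_measurable_simple_function [OF g(1)] T by (intro nn_integral_distr) auto
  also have "\<dots> \<le> (\<integral>\<^sup>+x. f (T x) \<partial>N)"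
    using g(2) by (intro nn_integral_mono) (auto simp: le_fun_def)
  finally show "integral\<^sup>S (distr N N' T) g \<le> (\<integral>\<^sup>+x. f (T x) \<partial>N)" .
qed

section \<open>The complex plane as \<open>real^2\<close>\<close>

definition vec_of_complex :: "complex \<Rightarrow> real^2" where
  "vec_of_complex z = vector [Re z, Im z]"

definition complex_of_vec :: "real^2 \<Rightarrow> complex" where
  "complex_of_vec x = Complex (x $ 1) (x $ 2)"

lemma vec_of_complex_inverse [simp]: "complex_of_vec (vec_of_complex z) = z"
  by (simp add: complex_of_vec_def vec_of_complex_def)

lemma complex_of_vec_inverse [simp]: "vec_of_complex (complex_of_vec x) = x"
  by (simp add: complex_of_vec_def vec_of_complex_def vec_eq_iff forall_2)

lemma linear_vec_of_complex: "linear vec_of_complex"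
  by (rule linearI) (simp_all add: vec_of_complex_def vec_eq_iff forall_2)

lemma linear_complex_of_vec: "linear complex_of_vec"
  by (rule linearI) (simp_all add: complex_of_vec_def complex_eq_iff)

lemma Basis_vec_2: "(Basis :: (real^2) set) = {axis 1 1, axis 2 1}"
  by (auto simp: Basis_vec_def UNIV_2)

lemma axis_2_neq [simp]: "axis 1 1 \<noteq> (axis 2 1 :: real^2)"
  by (simp add: axis_eq_axis)

lemma measurable_complex_of_vec: "complex_of_vec \<in> borel_measurable borel"
  using linear_complex_of_vec
  by (intro borel_measurable_continuous_onI linear_continuous_on) (simp add: linear_conv_bounded_linear)

text \<open>Lebesgue measure is determined by its values on boxes, and boxes pull back to boxes with
  the same sides.\<close>

lemma distr_complex_of_vec: "distr lborel borel complex_of_vec = lborel"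
proof (rule lborel_eqI [symmetric])
  fix l u :: complex
  assume lu: "\<And>b. b \<in> Basis \<Longrightarrow> l \<bullet> b \<le> u \<bullet> b"
  have "complex_of_vec -` box l u = box (vec_of_complex l) (vec_of_complex u)"
    by (auto simp: box_def Basis_complex_def Basis_vec_2 complex_of_vec_def vec_of_complex_def inner_axis)
  then have "emeasure (distr lborel borel complex_of_vec) (box l u) =
             emeasure lborel (box (vec_of_complex l) (vec_of_complex u))"
    using measurable_complex_of_vec by (simp add: emeasure_distr)
  also have "\<dots> = (\<Prod>b\<in>Basis. (u - l) \<bullet> b)"
    using lu [of 1] lu [of \<i>] by (subst emeasure_lborel_box)
      (auto simp: Basis_vec_2 Basis_complex_def vec_of_complex_def inner_axis)
  finally show "emeasure (distr lborel borel complex_of_vec) (box l u) = (\<Prod>b\<in>Basis. (u - l) \<bullet> b)" .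
qed simp

lemma measurable_vector_2: "(\<lambda>(s, t). vector [s, t] :: real^2) \<in> borel_measurable borel"
proof -
  have "linear (\<lambda>(s, t). vector [s, t] :: real^2)"
    by (rule linearI) (auto simp: vec_eq_iff forall_2)
  then show ?thesis
    by (intro borel_measurable_continuous_onI linear_continuous_on) (simp add: linear_conv_bounded_linear)
qed

lemma distr_vector_2: "distr lborel borel (\<lambda>(s, t). vector [s, t] :: real^2) = lborel"
proof (rule lborel_eqI [symmetric])
  fix l u :: "real^2"
  assume lu: "\<And>b. b \<in> Basis \<Longrightarrow> l \<bullet> b \<le> u \<bullet> b"
  have "(\<lambda>(s, t). vector [s, t] :: real^2) -` box l u = box (l $ 1, l $ 2) (u $ 1, u $ 2)"
    by (auto simp: box_def Basis_prod_def Basis_vec_2 inner_axis)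
  then have "emeasure (distr lborel borel (\<lambda>(s, t). vector [s, t] :: real^2)) (box l u) =
             emeasure lborel (box (l $ 1, l $ 2) (u $ 1, u $ 2))"
    using measurable_vector_2 by (simp add: emeasure_distr)
  also have "\<dots> = (\<Prod>b\<in>Basis. (u - l) \<bullet> b)"
    using lu [of "axis 1 1"] lu [of "axis 2 1"] by (subst emeasure_lborel_box)
      (auto simp: Basis_vec_2 Basis_prod_def inner_axis mult.commute)
  finally show "emeasure (distr lborel borel (\<lambda>(s, t). vector [s, t] :: real^2)) (box l u)
      = (\<Prod>b\<in>Basis. (u - l) \<bullet> b)" .
qed simp

text \<open>Tonelli's theorem, carried over from pairs to \<open>real^2\<close> by a
  measure-preserving map.\<close>

lemma nn_integral_vec_2:
  assumes "g \<in> borel_measurable borel"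
  shows "(\<integral>\<^sup>+x. g (x $ 1, x $ 2) \<partial>(lborel :: (real^2) measure)) = (\<integral>\<^sup>+s. \<integral>\<^sup>+t. g (s, t) \<partial>lborel \<partial>lborel)"
proof -
  have m: "(\<lambda>x::real^2. g (x $ 1, x $ 2)) \<in> borel_measurable borel"
  proof (rule measurable_compose [OF _ assms])
    show "(\<lambda>x::real^2. (x $ 1, x $ 2)) \<in> borel_measurable borel"
      by (intro borel_measurable_continuous_onI continuous_intros)
  qed
  have "(\<integral>\<^sup>+x. g (x $ 1, x $ 2) \<partial>(lborel :: (real^2) measure)) =
     (\<integral>\<^sup>+x. g (x $ 1, x $ 2) \<partial>distr lborel borel (\<lambda>(s, t). vector [s, t] :: real^2))"
    by (simp only: distr_vector_2)
  also have "\<dots> = (\<integral>\<^sup>+p. g p \<partial>lborel)"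
    using measurable_vector_2 m by (subst nn_integral_distr) (auto simp: case_prod_beta)
  also have "\<dots> = (\<integral>\<^sup>+p. g p \<partial>(lborel \<Otimes>\<^sub>M lborel))"
    by (simp only: lborel_prod)
  also have "\<dots> = (\<integral>\<^sup>+s. \<integral>\<^sup>+t. g (s, t) \<partial>lborel \<partial>lborel)"
    using assms by (subst lborel.nn_integral_fst) (simp_all add: lborel_prod)
  finally show ?thesis .
qed

section \<open>Polar coordinates\<close>

text \<open>Injectivity requires a positive radius and a half-open range of angles; the origin is
  the only point of the disk that is lost.\<close>

lemma bij_betw_rcis:
  "bij_betw (\<lambda>x :: real^2. rcis (x $ 1) (x $ 2)) {x. 0 < x $ 1 \<and> x $ 1 < r \<and> 0 \<le> x $ 2 \<and> x $ 2 < 2 * pi}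
     {z. z \<noteq> 0 \<and> norm z < r}"
proof (rule bij_betw_imageI)
  show "inj_on (\<lambda>x :: real^2. rcis (x $ 1) (x $ 2)) {x. 0 < x $ 1 \<and> x $ 1 < r \<and> 0 \<le> x $ 2 \<and> x $ 2 < 2 * pi}"
  proof (rule inj_onI, clarsimp)
    fix x y :: "real^2"
    assume x: "0 < x $ 1" "0 \<le> x $ 2" "x $ 2 < 2 * pi" and y: "0 < y $ 1" "0 \<le> y $ 2" "y $ 2 < 2 * pi"
      and eq: "rcis (x $ 1) (x $ 2) = rcis (y $ 1) (y $ 2)"
    have 1: "x $ 1 = y $ 1"
      using arg_cong [OF eq, of norm] x y by simp
    then have "cis (x $ 2) = cis (y $ 2)"
      using eq x by (simp add: rcis_def)
    moreover have "Arg2pi (cis (x $ 2)) = x $ 2" "Arg2pi (cis (y $ 2)) = y $ 2"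
      using x y by (auto intro!: Arg2pi_unique [of 1] simp: cis_conv_exp)
    ultimately have "x $ 2 = y $ 2" by metis
    with 1 show "x = y" by (simp add: vec_eq_iff forall_2)
  qed
  show "(\<lambda>x :: real^2. rcis (x $ 1) (x $ 2)) ` {x. 0 < x $ 1 \<and> x $ 1 < r \<and> 0 \<le> x $ 2 \<and> x $ 2 < 2 * pi}
     = {z. z \<noteq> 0 \<and> norm z < r}"
  proof (intro equalityI subsetI)
    fix z :: complex assume z: "z \<in> {z. z \<noteq> 0 \<and> norm z < r}"
    show "z \<in> (\<lambda>x :: real^2. rcis (x $ 1) (x $ 2)) ` {x. 0 < x $ 1 \<and> x $ 1 < r \<and> 0 \<le> x $ 2 \<and> x $ 2 < 2 * pi}"
      using z Arg2pi [of z] by (intro image_eqI [of _ _ "vector [norm z, Arg2pi z]"]) (auto simp: rcis_def cis_conv_exp is_Arg_def)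
  qed auto
qed

text \<open>Multiplication by \<open>c\<close> has real determinant |c|^2, and scaling the second
  coordinate by \<open>s\<close> contributes the factor \<open>s\<close>.\<close>

lemma det_complex_mult_polar:
  "det (matrix (\<lambda>h. vec_of_complex (c * Complex (h $ 1) (s * h $ 2)))) = s * (norm c)\<^sup>2"
  unfolding cmod_power2
  by (simp add: det_2 matrix_def vec_of_complex_def axis_def power2_eq_square algebra_simps)

text \<open>Chain rule: at radius s and angle t the polar map sends h to \<open>cis t\<close> times
  h_1 + i s h_2, and f then multiplies by its complex derivative.\<close>

lemma has_derivative_polar:
  assumes "f holomorphic_on ball 0 1" "norm (x $ 1) < 1"
  shows "((\<lambda>x :: real^2. vec_of_complex (f (rcis (x $ 1) (x $ 2)))) has_derivative
     (\<lambda>h. vec_of_complex (deriv f (rcis (x $ 1) (x $ 2)) * cis (x $ 2) * Complex (h $ 1) (x $ 1 * h $ 2)))) (at x within S)"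
proof -
  have "((\<lambda>x :: real^2. of_real (x $ 1) * cis (x $ 2)) has_derivative
      (\<lambda>h. of_real (x $ 1) * (h $ 2 *\<^sub>R (\<i> * cis (x $ 2))) + of_real (h $ 1) * cis (x $ 2))) (at x within S)"
    by (auto intro!: derivative_eq_intros bounded_linear.has_derivative [OF bounded_linear_vec_nth])
  then have p: "((\<lambda>x :: real^2. rcis (x $ 1) (x $ 2)) has_derivative
      (\<lambda>h. cis (x $ 2) * Complex (h $ 1) (x $ 1 * h $ 2))) (at x within S)"
    unfolding rcis_def
    by (rule has_derivative_eq_rhs) (simp add: fun_eq_iff complex_eq_iff algebra_simps)
  have "(f has_field_derivative deriv f (rcis (x $ 1) (x $ 2))) (at (rcis (x $ 1) (x $ 2)))"
    using assms by (intro holomorphic_derivI [of f "ball 0 1"]) auto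
  then have "(f has_derivative (\<lambda>h. deriv f (rcis (x $ 1) (x $ 2)) * h)) (at (rcis (x $ 1) (x $ 2)))"
    by (simp add: has_field_derivative_def)
  from has_derivative_compose [OF p this]
  have "((\<lambda>x :: real^2. f (rcis (x $ 1) (x $ 2))) has_derivative
      (\<lambda>h. deriv f (rcis (x $ 1) (x $ 2)) * (cis (x $ 2) * Complex (h $ 1) (x $ 1 * h $ 2)))) (at x within S)" .
  moreover have "bounded_linear vec_of_complex"
    using linear_vec_of_complex by (simp add: linear_conv_bounded_linear)
  ultimately show ?thesis
    using bounded_linear.has_derivative by (fastforce simp: mult.assoc)
qed

lemma fps_expansion_deriv_nth:
  "fps_nth (fps_expansion (deriv f) 0) k = of_nat (Suc k) * fps_nth (fps_expansion f 0) (Suc k)"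
  by (simp add: fps_expansion_def funpow_Suc_right del: funpow.simps of_nat_Suc)

text \<open>The counting bound applied to f in polar coordinates, where the Jacobian determinant is
  \<open>s\<close> times the squared modulus of f'.\<close>

lemma nn_integral_card_le:
  fixes f :: "complex \<Rightarrow> complex"
  assumes f: "f holomorphic_on ball 0 1" and r: "0 \<le> r" "r < 1"
  shows "(\<integral>\<^sup>+w. of_nat (card {z. norm z < r \<and> f z = w}) \<partial>lborel)
     \<le> (\<integral>\<^sup>+s. \<integral>\<^sup>+t. ennreal (s * (norm (deriv f (rcis s t)))\<^sup>2) * indicator {0..r} s * indicator {0..2 * pi} t \<partial>lborel \<partial>lborel)"
proof -
  define p :: "real^2 \<Rightarrow> complex" where "p x = rcis (x $ 1) (x $ 2)" for x
  define S :: "(real^2) set" where "S = {x. 0 < x $ 1 \<and> x $ 1 < r \<and> 0 \<le> x $ 2 \<and> x $ 2 < 2 * pi}"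
  define g where "g = (\<lambda>(s, t). s * (norm (deriv f (rcis s t)))\<^sup>2)"
  define F' where "F' x h = vec_of_complex (deriv f (p x) * cis (x $ 2) * Complex (h $ 1) (x $ 1 * h $ 2))"
    for x h :: "real^2"
  have det: "\<bar>det (matrix (F' x))\<bar> = g (x $ 1, x $ 2)" if "0 \<le> x $ 1" for x
    using that unfolding F'_def det_complex_mult_polar by (simp add: g_def p_def norm_mult)
  have S_borel: "S \<in> sets borel"
    unfolding S_def by measurable
  then have S_leb: "S \<in> sets lebesgue"
    by (simp add: sets_completionI_sets)
  have g_cont: "continuous_on ({0..r} \<times> {0..2 * pi}) g"
    unfolding g_def case_prod_beta using r f
    by (intro continuous_intros continuous_on_compose2 [OF holomorphic_on_imp_continuous_on [OF holomorphic_deriv [OF f open_ball]]])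
      auto
  have F_deriv: "((\<lambda>x. vec_of_complex (f (p x))) has_derivative F' x) (at x within S)" if "x \<in> S" for x
    unfolding p_def F'_def using that r by (intro has_derivative_polar f) (auto simp: S_def)
  have int: "(\<lambda>x. \<bar>det (matrix (F' x))\<bar>) integrable_on S"
  proof -
    let ?B = "cbox (vector [0, 0]) (vector [r, 2 * pi]) :: (real^2) set"
    have B: "x \<in> ?B \<longleftrightarrow> 0 \<le> x $ 1 \<and> x $ 1 \<le> r \<and> 0 \<le> x $ 2 \<and> x $ 2 \<le> 2 * pi" for x
      by (auto simp: mem_box_cart forall_2)
    have "continuous_on ?B (\<lambda>x. g (x $ 1, x $ 2))"
      by (intro continuous_on_compose2 [OF g_cont] continuous_intros) (auto simp: B)
    then have "(\<lambda>x. g (x $ 1, x $ 2)) absolutely_integrable_on ?B"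
      by (rule absolutely_integrable_continuous)
    then have "(\<lambda>x. g (x $ 1, x $ 2)) absolutely_integrable_on S"
      using S_leb by (rule set_integrable_subset) (auto simp: B S_def)
    then have "(\<lambda>x. g (x $ 1, x $ 2)) integrable_on S"
      by (rule set_lebesgue_integral_eq_integral)
    then show ?thesis
      by (rule integrable_eq) (auto simp: S_def det)
  qed
  \<comment> \<open>The value f(0) is excluded because the origin has no polar coordinates in
    \<open>S\<close>. A single value is a null set and does not affect the integrals.\<close>
  have card_eq: "card {z. norm z < r \<and> f z = complex_of_vec y} = card {x \<in> S. vec_of_complex (f (p x)) = y}"
    if "y \<noteq> vec_of_complex (f 0)" for y
  proof -
    have "bij_betw p {x \<in> S. f (p x) = complex_of_vec y} {z. norm z < r \<and> f z = complex_of_vec y}"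
    proof (rule bij_betw_subset [OF bij_betw_rcis [of r, folded p_def S_def]])
      have "f 0 \<noteq> complex_of_vec y" using that by auto
      moreover have "p ` S = {z. z \<noteq> 0 \<and> norm z < r}"
        using bij_betw_rcis [of r] unfolding p_def S_def by (rule bij_betw_imp_surj_on)
      moreover have "p ` {x \<in> S. f (p x) = complex_of_vec y} = {z \<in> p ` S. f z = complex_of_vec y}"
        by auto
      ultimately show "p ` {x \<in> S. f (p x) = complex_of_vec y} = {z. norm z < r \<and> f z = complex_of_vec y}"
        by auto
    qed auto
    moreover have "vec_of_complex (f (p x)) = y \<longleftrightarrow> f (p x) = complex_of_vec y" for x
      by auto
    ultimately show ?thesis
      by (simp add: bij_betw_same_card)
  qed
  have "(\<integral>\<^sup>+w. of_nat (card {z. norm z < r \<and> f z = w}) \<partial>lborel) =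
      (\<integral>\<^sup>+w. of_nat (card {z. norm z < r \<and> f z = w}) \<partial>distr lborel borel complex_of_vec)"
    unfolding distr_complex_of_vec ..
  also have "\<dots> \<le> (\<integral>\<^sup>+y. of_nat (card {z. norm z < r \<and> f z = complex_of_vec y}) \<partial>lborel)"
    using nn_integral_distr_le [of complex_of_vec lborel borel] measurable_complex_of_vec by simp
  also have "\<dots> = (\<integral>\<^sup>+y. of_nat (card {x \<in> S. vec_of_complex (f (p x)) = y}) \<partial>lborel)"
  proof (rule nn_integral_cong_AE)
    have "AE y in lborel. y \<noteq> vec_of_complex (f 0)"
      by (rule AE_lborel_singleton)
    then show "AE y in lborel. of_nat (card {z. norm z < r \<and> f z = complex_of_vec y}) =
        (of_nat (card {x \<in> S. vec_of_complex (f (p x)) = y}) :: ennreal)"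
      by eventually_elim (simp add: card_eq)
  qed
  also have "\<dots> \<le> (\<integral>\<^sup>+x. ennreal \<bar>det (matrix (F' x))\<bar> * indicator S x \<partial>lborel)"
    using nn_integral_card_vimage_le [OF S_leb F_deriv int] by (simp add: nn_integral_completion)
  also have "\<dots> \<le> (\<integral>\<^sup>+x. ennreal (g (x $ 1, x $ 2)) * indicator {0..r} (x $ 1) * indicator {0..2 * pi} (x $ 2)
      \<partial>(lborel :: (real^2) measure))"
    by (intro nn_integral_mono) (auto simp: S_def det indicator_def)
  also have "\<dots> = (\<integral>\<^sup>+s. \<integral>\<^sup>+t. ennreal (g (s, t)) * indicator {0..r} s * indicator {0..2 * pi} t \<partial>lborel \<partial>lborel)"
  proof -
    have "(\<lambda>q. indicator ({0..r} \<times> {0..2 * pi}) q *\<^sub>R g q) \<in> borel_measurable borel"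
      by (intro borel_measurable_continuous_on_indicator g_cont) (auto intro!: borel_closed closed_Times)
    then have "(\<lambda>q. ennreal (indicator ({0..r} \<times> {0..2 * pi}) q *\<^sub>R g q)) \<in> borel_measurable borel"
      by measurable
    moreover have "(\<lambda>q. ennreal (indicator ({0..r} \<times> {0..2 * pi}) q *\<^sub>R g q)) =
        (\<lambda>q. ennreal (g q) * indicator {0..r} (fst q) * indicator {0..2 * pi} (snd q))"
      by (auto simp: fun_eq_iff indicator_def)
    ultimately show ?thesis
      using nn_integral_vec_2 [of "\<lambda>q. ennreal (g q) * indicator {0..r} (fst q) * indicator {0..2 * pi} (snd q)"]
      by simp
  qed
  finally show ?thesis
    by (simp add: g_def)
qed

text \<open>Parseval turns each angular integral into a power series in the radius, whose
  nonnegative terms are integrated one by one. Since f' has coefficients (k + 1) a_{k+1}, the factor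
  2 pi / (2 k + 2) leaves pi (k + 1) |a_{k+1}|^2.\<close>

lemma image_area_le:
  assumes f: "f holomorphic_on ball 0 1" and r: "0 \<le> r" "r < 1"
    and C: "\<And>n. (\<Sum>k<n. real (Suc k) * (norm (fps_nth (fps_expansion f 0) (Suc k)))\<^sup>2 * r ^ (2 * Suc k)) \<le> C"
  shows "image_area f r \<le> pi * C"
proof -
  define b where "b k = (norm (fps_nth (fps_expansion (deriv f) 0) k))\<^sup>2" for k
  have f': "deriv f holomorphic_on ball 0 1"
    by (intro holomorphic_deriv f) auto
  have inner: "(\<integral>\<^sup>+t. ennreal (s * (norm (deriv f (rcis s t)))\<^sup>2) * indicator {0..r} s * indicator {0..2 * pi} t \<partial>lborel)
     = (\<Sum>k. ennreal (2 * pi * b k * s ^ (2 * k + 1)) * indicator {0..r} s)" for s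
  proof (cases "s \<in> {0..r}")
    case True
    then obtain m where m: "(\<lambda>k. b k * s ^ (2 * k)) sums m"
      and int: "((\<lambda>t. (norm (deriv f (rcis s t)))\<^sup>2) has_integral 2 * pi * m) {0..2 * pi}"
      using parseval_circle [OF sums_fps_expansion [OF f'], of s] r unfolding b_def by auto
    have "(\<integral>\<^sup>+t. ennreal (s * (norm (deriv f (rcis s t)))\<^sup>2) * indicator {0..2 * pi} t \<partial>lborel) = ennreal (s * (2 * pi * m))"
      using True int by (intro nn_integral_has_integral_lebesgue' has_integral_mult_right) auto
    also have "\<dots> = (\<Sum>k. ennreal (s * (2 * pi * (b k * s ^ (2 * k)))))"
      using True m by (intro suminf_ennreal_eq [symmetric] sums_mult) (auto simp: b_def)
    finally show ?thesis
      using True by (simp add: mult_ac)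
  qed simp
  have outer: "(\<integral>\<^sup>+s. ennreal (2 * pi * b k * s ^ (2 * k + 1)) * indicator {0..r} s \<partial>lborel)
      = ennreal (pi * (real (Suc k) * (norm (fps_nth (fps_expansion f 0) (Suc k)))\<^sup>2 * r ^ (2 * Suc k)))" for k
  proof -
    have "((\<lambda>s. s ^ (2 * k + 1)) has_integral r ^ (2 * k + 2) / real (2 * k + 2) - 0 ^ (2 * k + 2) / real (2 * k + 2)) {0..r}"
      using r(1)
    proof (intro fundamental_theorem_of_calculus)
      fix s
      have "((\<lambda>s. s ^ (2 * k + 2) / real (2 * k + 2)) has_real_derivative
          real (2 * k + 2) * s ^ (2 * k + 2 - Suc 0) / real (2 * k + 2)) (at s within {0..r})"
        by (intro DERIV_cdivide DERIV_pow)
      then show "((\<lambda>s. s ^ (2 * k + 2) / real (2 * k + 2)) has_vector_derivative s ^ (2 * k + 1)) (at s within {0..r})"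
        by (subst (asm) nonzero_mult_div_cancel_left)
          (simp_all add: has_real_derivative_iff_has_vector_derivative)
    qed
    then have "((\<lambda>s. 2 * pi * b k * s ^ (2 * k + 1)) has_integral 2 * pi * b k * (r ^ (2 * k + 2) / real (2 * k + 2))) {0..r}"
      by (intro has_integral_mult_right) simp
    then have "(\<integral>\<^sup>+s. ennreal (2 * pi * b k * s ^ (2 * k + 1)) * indicator {0..r} s \<partial>lborel)
        = ennreal (2 * pi * b k * (r ^ (2 * k + 2) / real (2 * k + 2)))"
      by (intro nn_integral_has_integral_lebesgue') (auto simp: b_def)
    also have "2 * pi * b k * (r ^ (2 * k + 2) / real (2 * k + 2)) =
       pi * (real (Suc k) * (norm (fps_nth (fps_expansion f 0) (Suc k)))\<^sup>2 * r ^ (2 * Suc k))"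
    proof -
      have "real (2 * k + 2) = 2 * real (Suc k)" by simp
      then show ?thesis
        unfolding b_def fps_expansion_deriv_nth norm_mult norm_of_nat power_mult_distrib
        by (simp add: power2_eq_square del: of_nat_Suc)
    qed
    finally show ?thesis .
  qed
  have C0: "0 \<le> C" using C [of 0] by simp
  have "(\<integral>\<^sup>+w. of_nat (card {z. norm z < r \<and> f z = w}) \<partial>lborel) \<le>
      (\<integral>\<^sup>+s. (\<Sum>k. ennreal (2 * pi * b k * s ^ (2 * k + 1)) * indicator {0..r} s) \<partial>lborel)"
    using nn_integral_card_le [OF f r] by (simp only: inner)
  also have "\<dots> = (\<Sum>k. ennreal (pi * (real (Suc k) * (norm (fps_nth (fps_expansion f 0) (Suc k)))\<^sup>2 * r ^ (2 * Suc k))))"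
    by (subst nn_integral_suminf) (simp_all only: outer, measurable)
  also have "\<dots> \<le> ennreal (pi * C)"
  proof (rule suminf_le_const)
    fix n
    have "(\<Sum>k<n. ennreal (pi * (real (Suc k) * (norm (fps_nth (fps_expansion f 0) (Suc k)))\<^sup>2 * r ^ (2 * Suc k))))
       = ennreal (pi * (\<Sum>k<n. real (Suc k) * (norm (fps_nth (fps_expansion f 0) (Suc k)))\<^sup>2 * r ^ (2 * Suc k)))"
      unfolding sum_distrib_left using r by (intro sum_ennreal) auto
    also have "\<dots> \<le> ennreal (pi * C)"
      using C by (intro ennreal_leI mult_left_mono) auto
    finally show "(\<Sum>k<n. ennreal (pi * (real (Suc k) * (norm (fps_nth (fps_expansion f 0) (Suc k)))\<^sup>2 * r ^ (2 * Suc k)))) \<le> ennreal (pi * C)" .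
  qed simp
  finally have nn: "(\<integral>\<^sup>+w. ennreal (real (card {z. norm z < r \<and> f z = w})) \<partial>lborel) \<le> ennreal (pi * C)"
    by (simp add: ennreal_of_nat_eq_real_of_nat)
  show ?thesis
  \<comment> \<open>If the count is not integrable, \<open>image_area\<close> is 0 by convention,
    and the bound follows from C \<ge> 0.\<close>
  proof (cases "integrable lborel (\<lambda>w. real (card {z. norm z < r \<and> f z = w}))")
    case True
    then have "ennreal (image_area f r) = (\<integral>\<^sup>+w. ennreal (real (card {z. norm z < r \<and> f z = w})) \<partial>lborel)"
      unfolding image_area_def by (intro nn_integral_eq_integral [symmetric]) auto
    with nn have "ennreal (image_area f r) \<le> ennreal (pi * C)" by simp
    then show ?thesis using C0 by (subst (asm) ennreal_le_iff) auto
  next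
    case False
    then show ?thesis
      using C0 by (simp add: image_area_def not_integrable_integral_eq)
  qed
qed

section \<open>The Moebius map\<close>

lemma moebius_denominator_nonzero:
  assumes "0 < a" "a < 1" "norm (z :: complex) < 1"
  shows "1 - of_real a * z \<noteq> 0"
proof
  assume "1 - of_real a * z = 0"
  then have "norm (of_real a * z) = 1" by simp
  moreover have "a * norm z < 1 * 1"
    using assms by (intro mult_strict_mono) auto
  ultimately show False using assms by (simp add: norm_mult)
qed

text \<open>The Moebius map is its own inverse, so each \<open>w\<close> has at most one preimage,
  namely its own image.\<close>

lemma moebius_preimage:
  fixes w z :: complex
  assumes a: "0 < a" "a < 1" and r: "0 < r" "r < 1"
  shows "norm z < r \<and> (of_real a - z) / (1 - of_real a * z) = w \<longleftrightarrow>
     norm (of_real a - w) < r * norm (1 - of_real a * w) \<and> z = (of_real a - w) / (1 - of_real a * w)"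
proof (intro iffI conjI)
  assume "norm z < r \<and> (of_real a - z) / (1 - of_real a * z) = w"
  then have z: "norm z < r" and w: "(of_real a - z) / (1 - of_real a * z) = w" by auto
  have nz: "1 - of_real a * z \<noteq> 0"
    using a z r by (intro moebius_denominator_nonzero) auto
  then have eq: "of_real a - z = w * (1 - of_real a * z)"
    using w by (simp add: field_simps)
  \<comment> \<open>The product of the two denominators is 1 - a^2, which is nonzero, so
    \<open>w\<close> is not the pole.\<close>
  have "(1 - of_real a * z) * (1 - of_real a * w) = 1 - of_real a * z - of_real a * (w * (1 - of_real a * z))"
    by (simp add: algebra_simps)
  also have "\<dots> = 1 - of_real (a\<^sup>2)"
    unfolding eq [symmetric] by (simp add: algebra_simps power2_eq_square)
  also have "\<dots> \<noteq> 0"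
    using a by (simp add: power2_eq_1_iff flip: of_real_power)
  finally have nz': "1 - of_real a * w \<noteq> 0" by auto
  have "z * (1 - of_real a * w) = of_real a - w"
    using eq by (simp add: algebra_simps)
  then show "z = (of_real a - w) / (1 - of_real a * w)"
    using nz' by (simp add: field_simps)
  with z nz' show "norm (of_real a - w) < r * norm (1 - of_real a * w)"
    by (simp add: norm_divide field_simps)
next
  assume *: "norm (of_real a - w) < r * norm (1 - of_real a * w) \<and> z = (of_real a - w) / (1 - of_real a * w)"
  then have nz': "1 - of_real a * w \<noteq> 0"
    by (metis mult_zero_right norm_ge_zero norm_zero not_less)
  have "norm (of_real a - w) / norm (1 - of_real a * w) < r"
    using * nz' by (subst pos_divide_less_eq) auto
  then show z: "norm z < r"
    using * by (simp only: norm_divide)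
  then have nz: "1 - of_real a * z \<noteq> 0"
    using a r by (intro moebius_denominator_nonzero) auto
  have "z * (1 - of_real a * w) = of_real a - w"
    using * nz' by simp
  then have "of_real a - z = w * (1 - of_real a * z)"
    by (simp add: algebra_simps)
  then show "(of_real a - z) / (1 - of_real a * z) = w"
    using nz by (simp add: field_simps)
qed

text \<open>A disk of Apollonius: completing the square in the squared inequality yields the centre
  and the radius.\<close>

lemma moebius_image_ball:
  assumes a: "0 < a" "a < 1" and r: "0 < r" "r < 1"
  shows "{w :: complex. norm (of_real a - w) < r * norm (1 - of_real a * w)} =
    ball (of_real (a * (1 - r\<^sup>2) / (1 - a\<^sup>2 * r\<^sup>2))) (r * (1 - a\<^sup>2) / (1 - a\<^sup>2 * r\<^sup>2))"
proof -
  define d where "d = 1 - a\<^sup>2 * r\<^sup>2"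
  define c where "c = a * (1 - r\<^sup>2) / d"
  define R where "R = r * (1 - a\<^sup>2) / d"
  have sq: "a\<^sup>2 < 1" "r\<^sup>2 < 1"
    using a r by (auto simp: power_less_one_iff)
  then have "a\<^sup>2 * r\<^sup>2 < 1 * 1"
    using a by (intro mult_strict_mono) auto
  then have d: "0 < d" by (simp add: d_def)
  have R: "0 < R" using d r sq by (simp add: R_def)
  have cR: "d * c = a * (1 - r\<^sup>2)" "d * R = r * (1 - a\<^sup>2)"
    using d by (auto simp: c_def R_def)
  have key: "(r * norm (1 - of_real a * w))\<^sup>2 - (norm (of_real a - w))\<^sup>2 =
        d * (R\<^sup>2 - (norm (of_real c - w))\<^sup>2)" for w :: complex
  proof -
    \<comment> \<open>The second factor \<open>d\<close> is there so that centre and radius occur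
      only as \<open>d * c\<close> and \<open>d * R\<close>, which are polynomials in a and
      r.\<close>
    have "d * (d * (R\<^sup>2 - (norm (of_real c - w))\<^sup>2)) =
      (d * R)\<^sup>2 - ((d * c - d * Re w)\<^sup>2 + (d * Im w)\<^sup>2)"
      unfolding cmod_power2 by (simp add: power2_eq_square algebra_simps)
    also have "\<dots> = d * ((r * norm (1 - of_real a * w))\<^sup>2 - (norm (of_real a - w))\<^sup>2)"
      unfolding cR power_mult_distrib cmod_power2
      by (simp add: d_def power2_eq_square algebra_simps)
    finally show ?thesis using d by simp
  qed
  have "norm (of_real a - w) < r * norm (1 - of_real a * w) \<longleftrightarrow> norm (of_real c - w) < R" for w :: complex
  proof -
    have "norm (of_real a - w) < r * norm (1 - of_real a * w) \<longleftrightarrow>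
        (norm (of_real a - w))\<^sup>2 < (r * norm (1 - of_real a * w))\<^sup>2"
      using r by (simp add: power_mono_iff flip: not_le)
    also have "\<dots> \<longleftrightarrow> 0 < d * (R\<^sup>2 - (norm (of_real c - w))\<^sup>2)"
      unfolding key [symmetric] by auto
    also have "\<dots> \<longleftrightarrow> (norm (of_real c - w))\<^sup>2 < R\<^sup>2"
      using d by (simp add: zero_less_mult_iff)
    also have "\<dots> \<longleftrightarrow> norm (of_real c - w) < R"
      using R by (simp add: power_mono_iff flip: not_le)
    finally show ?thesis .
  qed
  then show ?thesis
    by (auto simp: ball_def dist_norm c_def R_def d_def)
qed

lemma image_area_moebius:
  assumes a: "0 < a" "a < 1" and r: "0 < r" "r < 1"
  shows "image_area (\<lambda>z. (of_real a - z) / (1 - of_real a * z)) r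
     = pi * (r * (1 - a\<^sup>2) / (1 - a\<^sup>2 * r\<^sup>2))\<^sup>2"
proof -
  define B where "B = {w :: complex. norm (of_real a - w) < r * norm (1 - of_real a * w)}"
  have R: "0 \<le> r * (1 - a\<^sup>2) / (1 - a\<^sup>2 * r\<^sup>2)"
  proof -
    have "a\<^sup>2 \<le> 1" "r\<^sup>2 \<le> 1" using a r by (auto simp: power_le_one)
    then show ?thesis using r by (auto simp: mult_le_one intro!: divide_nonneg_nonneg mult_nonneg_nonneg)
  qed
  have "real (card {z. norm z < r \<and> (of_real a - z) / (1 - of_real a * z) = w}) = indicator B w" for w
    unfolding moebius_preimage [OF a r] by (cases "w \<in> B") (auto simp: B_def)
  then have "image_area (\<lambda>z. (of_real a - z) / (1 - of_real a * z)) r = (LINT w|lborel. indicator B w)"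
    by (simp add: image_area_def)
  also have "\<dots> = measure lborel B"
    by simp
  also have "\<dots> = pi * (r * (1 - a\<^sup>2) / (1 - a\<^sup>2 * r\<^sup>2))\<^sup>2"
    unfolding B_def moebius_image_ball [OF a r] content_ball [OF R] by (simp add: unit_ball_vol_2)
  finally show ?thesis .
qed

lemma moebius_holomorphic:
  assumes "0 < a" "a < 1"
  shows "(\<lambda>z. (of_real a - z) / (1 - of_real a * z)) holomorphic_on ball 0 1"
  using moebius_denominator_nonzero [OF assms] by (intro holomorphic_intros) auto

lemma moebius_norm_le_1:
  assumes "0 < a" "a < 1" "norm (z :: complex) < 1"
  shows "norm ((of_real a - z) / (1 - of_real a * z)) \<le> 1"
  using norm_diff_le_norm_one_minus_cnj_mult [of "of_real a" z] moebius_denominator_nonzero [OF assms] assms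
  by (simp add: norm_divide)

text \<open>Clearing the denominator gives (1 - a X) G = a - X, from which the coefficients follow
  recursively.\<close>

lemma fps_expansion_moebius:
  assumes a: "0 < a" "a < 1"
  defines "G \<equiv> fps_expansion (\<lambda>z. (of_real a - z) / (1 - of_real a * z)) 0"
  shows "fps_nth G 0 = of_real a" "fps_nth G (Suc k) = of_real ((a\<^sup>2 - 1) * a ^ k)"
proof -
  define g :: "complex \<Rightarrow> complex" where "g z = (of_real a - z) / (1 - of_real a * z)" for z
  have "g has_fps_expansion G"
    using moebius_holomorphic [OF a] unfolding G_def g_def
    by (intro has_fps_expansion_fps_expansion [of "ball 0 1"]) auto
  then have "(\<lambda>z. (1 - of_real a * z) * g z) has_fps_expansion (1 - fps_const (of_real a) * fps_X) * G"
    by (intro fps_expansion_intros)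
  moreover have "\<forall>\<^sub>F z in nhds 0. (1 - of_real a * z) * g z = of_real a - z"
  proof (rule eventually_nhds_in_open [of "ball 0 1", THEN eventually_mono])
    show "(1 - of_real a * z) * g z = of_real a - z" if "z \<in> ball 0 1" for z
      using moebius_denominator_nonzero [OF a, of z] that by (simp add: g_def)
  qed auto
  ultimately have "(\<lambda>z. of_real a - z) has_fps_expansion (1 - fps_const (of_real a) * fps_X) * G"
    by (simp only: has_fps_expansion_cong [OF _ refl])
  moreover have "(\<lambda>z :: complex. of_real a - z) has_fps_expansion fps_const (of_real a) - fps_X"
    by (intro fps_expansion_intros)
  ultimately have eq: "(1 - fps_const (of_real a) * fps_X) * G = fps_const (of_real a) - fps_X"
    by (rule fps_expansion_unique_complex)
  then have eq': "G = fps_const (of_real a) - fps_X + fps_const (of_real a) * (fps_X * G)"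
    by (simp add: algebra_simps)
  show G0: "fps_nth G 0 = of_real a"
    by (subst eq') simp
  show "fps_nth G (Suc k) = of_real ((a\<^sup>2 - 1) * a ^ k)"
  proof (induction k)
    case 0
    show ?case by (subst eq') (simp add: G0 power2_eq_square)
  next
    case (Suc k)
    have "fps_nth G (Suc (Suc k)) = of_real a * fps_nth G (Suc k)"
      by (subst eq') (simp add: fps_X_nth)
    then show ?case using Suc by simp
  qed
qed

text \<open>A geometric series; apart from the leading \<open>a\<close> its value is the bound of
  \<open>coeff_sum_le_large\<close>.\<close>

lemma coeff_sum_moebius:
  assumes a: "0 < a" "a < 1"
  shows "(\<Sum>k. norm (fps_nth (fps_expansion (\<lambda>z. (of_real a - z) / (1 - of_real a * z)) 0) k) * (1 / 3) ^ k)
     = a + (1 - a\<^sup>2) / (3 - a)"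
proof -
  define x where "x k = norm (fps_nth (fps_expansion (\<lambda>z. (of_real a - z) / (1 - of_real a * z)) 0) k) * (1 / 3) ^ k" for k
  have "a\<^sup>2 < 1" using a by (simp add: power_less_one_iff)
  then have xS: "x (Suc k) = (1 - a\<^sup>2) / 3 * (a / 3) ^ k" for k
    unfolding x_def fps_expansion_moebius [OF a] norm_of_real
    using a by (simp add: abs_mult power_divide)
  have "(\<lambda>k. (1 - a\<^sup>2) / 3 * (a / 3) ^ k) sums ((1 - a\<^sup>2) / 3 * (1 / (1 - a / 3)))"
    using a by (intro sums_mult geometric_sums) auto
  have "(\<lambda>k. x (Suc k)) sums ((1 - a\<^sup>2) / (3 - a))"
  proof -
    have "1 - a / 3 = (3 - a) / 3" by simp
    then show ?thesis
      using \<open>(\<lambda>k. (1 - a\<^sup>2) / 3 * (a / 3) ^ k) sums ((1 - a\<^sup>2) / 3 * (1 / (1 - a / 3)))\<close>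
      by (simp add: xS)
  qed
  then have "x sums ((1 - a\<^sup>2) / (3 - a) + x 0)"
    by (rule sums_Suc)
  then show ?thesis
    using a unfolding x_def [abs_def, symmetric]
    by (simp add: sums_iff) (simp add: x_def fps_expansion_moebius [OF a])
qed

section \<open>Inequalities in one real variable\<close>

text \<open>All coefficients except the constant one are positive, and the linear term provides
  strictness.\<close>

lemma psi_strict_mono:
  assumes "0 \<le> s" "s < t"
  shows "psi s < psi t"
proof -
  have "s ^ n \<le> t ^ n" for n using assms by (intro power_mono) auto
  from this [of 2] this [of 3] this [of 4] this [of 5] assms show ?thesis
    unfolding psi_def by linarith
qed

section \<open>The critical value of \<lambda>\<close>

text \<open>The value of \<lambda> for which the Moebius map with parameter t, 0 < t < 1, gives
  exactly \<open>M = 1\<close> at radius 1/3.\<close>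

definition crit :: "real \<Rightarrow> real" where
  "crit t = 2 * (9 - t\<^sup>2)\<^sup>2 * (19 + 12 * t + t\<^sup>2) / (81 * (1 - t) * (1 + t) ^ 4)"

text \<open>After cross-multiplication and cancellation the two closed forms differ by
  \<open>(9 - a\<^sup>2) * psi a\<close>, so they agree at a root of \<open>psi\<close>.\<close>

lemma lambda_of_eq_crit:
  assumes "0 < a" "a < 3 / 5" "psi a = 0"
  shows "lambda_of a = crit a"
proof -
  have "2 * (486 - 261 * a - 324 * a^2 + 2 * a^3 + 30 * a^4 + 3 * a^5) * ((1 - a) * (1 + a)) -
      (9 - a\<^sup>2)\<^sup>2 * (19 + 12 * a + a\<^sup>2) * (3 - 5 * a) = (9 - a\<^sup>2) * psi a"
    unfolding psi_def by algebra
  then have eq: "2 * (486 - 261 * a - 324 * a^2 + 2 * a^3 + 30 * a^4 + 3 * a^5) * ((1 - a) * (1 + a)) =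
      (9 - a\<^sup>2)\<^sup>2 * (19 + 12 * a + a\<^sup>2) * (3 - 5 * a)"
    using assms by simp
  have "4 * (486 - 261 * a - 324 * a^2 + 2 * a^3 + 30 * a^4 + 3 * a^5) * (81 * (1 - a) * (1 + a) ^ 4) =
     2 * (9 - a\<^sup>2)\<^sup>2 * (19 + 12 * a + a\<^sup>2) * (81 * (1 + a)^3 * (3 - 5 * a))"
    using eq by algebra
  then show ?thesis
    using assms unfolding lambda_of_def crit_def by (subst frac_eq_eq) auto
qed

text \<open>The logarithmic derivative of \<open>crit\<close> has the sign of \<open>psi\<close>:
  nonpositive up to the root and nonnegative after it. \<open>L\<close> is the logarithm of
  \<open>crit\<close> up to the constant factor 2/81.\<close>

lemma crit_minimal:
  assumes a: "0 < a" "a < 1" "psi a = 0" and t: "0 \<le> t" "t < 1"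
  shows "crit a \<le> crit t"
proof -
  define L where "L t = 2 * ln (9 - t\<^sup>2) + ln (19 + 12 * t + t\<^sup>2) - ln (1 - t) - 4 * ln (1 + t)" for t :: real
  have pos: "0 < 9 - x\<^sup>2" "0 < 19 + 12 * x + x\<^sup>2" "0 < 1 - x" "0 < 1 + x" if "0 \<le> x" "x < 1" for x :: real
  proof -
    have "x\<^sup>2 \<le> 1" using that by (simp add: power_le_one)
    then show "0 < 9 - x\<^sup>2" by simp
    show "0 < 19 + 12 * x + x\<^sup>2" using that by (simp add: add_pos_nonneg)
  qed (use that in auto)
  have exp_L: "crit x = 2 / 81 * exp (L x)" if "0 \<le> x" "x < 1" for x
    using pos [OF that] by (simp add: L_def crit_def exp_add exp_diff exp_of_nat_mult [of 2, simplified]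
        exp_of_nat_mult [of 4, simplified] del: right_diff_distrib_numeral)
  have L_deriv: "(L has_real_derivative psi x / ((9 - x\<^sup>2) * (19 + 12 * x + x\<^sup>2) * ((1 - x) * (1 + x)))) (at x)"
    if "0 \<le> x" "x < 1" for x
  proof -
    note p = pos [OF that]
    have "(L has_real_derivative 2 * ((- 2 * x) / (9 - x\<^sup>2)) + (12 + 2 * x) / (19 + 12 * x + x\<^sup>2)
        - (- 1) / (1 - x) - 4 * (1 / (1 + x))) (at x)"
      unfolding L_def using p by (auto intro!: derivative_eq_intros simp: divide_inverse)
    moreover have "2 * ((- 2 * x) / (9 - x\<^sup>2)) + (12 + 2 * x) / (19 + 12 * x + x\<^sup>2)
        - (- 1) / (1 - x) - 4 * (1 / (1 + x)) = psi x / ((9 - x\<^sup>2) * (19 + 12 * x + x\<^sup>2) * ((1 - x) * (1 + x)))"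
    proof -
      \<comment> \<open>The factors stay opaque while the denominators are cleared and are expanded
        only for the polynomial identity.\<close>
      define A B C D where "A = 9 - x\<^sup>2" and "B = 19 + 12 * x + x\<^sup>2" and "C = 1 - x" and "D = 1 + x"
      have nz: "A \<noteq> 0" "B \<noteq> 0" "C \<noteq> 0" "D \<noteq> 0"
        using p by (auto simp: A_def B_def C_def D_def)
      have "2 * ((- 2 * x) / A) + (12 + 2 * x) / B - (- 1) / C - 4 * (1 / D) =
          ((- 4 * x) * B * (C * D) + (12 + 2 * x) * A * (C * D) + A * B * D - 4 * (A * B * C)) / (A * B * (C * D))"
        using nz by (simp add: field_simps)
      also have "(- 4 * x) * B * (C * D) + (12 + 2 * x) * A * (C * D) + A * B * D - 4 * (A * B * C) = psi x"
        unfolding A_def B_def C_def D_def psi_def by algebra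
      finally show ?thesis unfolding A_def B_def C_def D_def .
    qed
    ultimately show ?thesis by simp
  qed
  have den: "0 < (9 - x\<^sup>2) * (19 + 12 * x + x\<^sup>2) * ((1 - x) * (1 + x))" if "0 \<le> x" "x < 1" for x :: real
    using pos [OF that] by simp
  have "L a \<le> L t"
  proof (cases "a \<le> t")
    case True
    show ?thesis
    proof (rule DERIV_nonneg_imp_nondecreasing [OF True])
      fix x assume x: "a \<le> x" "x \<le> t"
      then have "0 \<le> psi x"
        using psi_strict_mono [of a x] a by (cases "x = a") auto
      then show "\<exists>y. DERIV L x :> y \<and> 0 \<le> y"
        using L_deriv [of x] den [of x] x a t
        by (intro exI [of _ "psi x / ((9 - x\<^sup>2) * (19 + 12 * x + x\<^sup>2) * ((1 - x) * (1 + x)))"] conjI divide_nonneg_pos) auto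
    qed
  next
    case False
    then have "t \<le> a" by simp
    then show ?thesis
    proof (rule DERIV_nonpos_imp_nonincreasing)
      fix x assume x: "t \<le> x" "x \<le> a"
      then have "psi x \<le> 0"
        using psi_strict_mono [of x a] a t by (cases "x = a") auto
      then show "\<exists>y. DERIV L x :> y \<and> y \<le> 0"
        using L_deriv [of x] den [of x] x a t
        by (intro exI [of _ "psi x / ((9 - x\<^sup>2) * (19 + 12 * x + x\<^sup>2) * ((1 - x) * (1 + x)))"] conjI divide_nonpos_pos) auto
    qed
  qed
  then show ?thesis
    using a t by (simp add: exp_L)
qed

text \<open>A sign change on an interval of length 10^(-7), short enough for the decimals of both a
  and \<lambda>.\<close>

lemma psi_root:
  obtains a where "0.5672839 \<le> a" "a \<le> 0.567284" "psi a = 0"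
proof -
  have "continuous_on {0.5672839..0.567284} psi"
    unfolding psi_def by (intro continuous_intros)
  moreover have "psi 0.5672839 \<le> 0" "0 \<le> psi 0.567284"
    by (simp_all add: psi_def power_divide)
  ultimately show thesis
    using IVT' [of psi "0.5672839" 0 "0.567284"] that by auto
qed

text \<open>Above, minimality allows evaluation at the decimal endpoint 0.567284. Below, each factor
  is replaced by its least favourable value on the interval.\<close>

lemma crit_bounds:
  assumes a: "0.5672839 \<le> a" "a \<le> 0.567284" and psi: "psi a = 0"
  shows "18.6095 \<le> crit a" "crit a < 18.6096"
proof -
  have "crit a \<le> crit 0.567284"
    using a psi by (intro crit_minimal) auto
  also have "\<dots> < 18.6096"
    by (simp add: crit_def power_divide)
  finally show "crit a < 18.6096" .
  have "a\<^sup>2 \<le> 0.567284\<^sup>2" "0.5672839\<^sup>2 \<le> a\<^sup>2"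
    using a by (intro power_mono; simp)+
  then have sq: "0.321811 \<le> a\<^sup>2" "a\<^sup>2 \<le> 0.3218112"
    by (simp_all add: power_divide)
  have "(18.6095::real) \<le> 2 * (9 - 0.3218112)\<^sup>2 * (19 + 12 * 0.5672839 + 0.321811) / (81 * (1 - 0.5672839) * (1 + 0.567284) ^ 4)"
    by (simp add: power_divide)
  also have "\<dots> \<le> crit a"
    unfolding crit_def using a sq by (intro frac_le mult_mono power_mono) auto
  finally show "18.6095 \<le> crit a" .
qed

section \<open>Inequalities in the modulus of the constant coefficient\<close>

text \<open>This is the room left for the squared area by the Moebius map with parameter t. Divided
  by 81 u^4, where u = (1 - t^2) / (9 - t^2), it becomes \<open>crit t\<close>.\<close>

lemma bohr_sum_identity:
  fixes t :: real
  assumes "0 \<le> t" "t \<le> 1"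
  shows "1 - (t + (1 - t\<^sup>2) / (3 - t) + 16 * ((1 - t\<^sup>2) / (9 - t\<^sup>2))\<^sup>2) =
     2 * (1 - t) ^ 3 * (19 + 12 * t + t\<^sup>2) / (9 - t\<^sup>2)\<^sup>2"
proof -
  have nz: "3 - t \<noteq> 0" "3 + t \<noteq> 0" using assms by auto
  have "9 - t\<^sup>2 = (3 - t) * (3 + t)" by (simp add: power2_eq_square algebra_simps)
  then show ?thesis
    using nz by (simp add: divide_simps) (simp add: power2_eq_square power3_eq_cube algebra_simps)
qed

lemma crit_mult_pow:
  assumes "0 \<le> t" "t < 1"
  shows "81 * crit t * ((1 - t\<^sup>2) / (9 - t\<^sup>2)) ^ 4 = 2 * (1 - t) ^ 3 * (19 + 12 * t + t\<^sup>2) / (9 - t\<^sup>2)\<^sup>2"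
proof -
  define d where "d = 9 - t\<^sup>2"
  have "t\<^sup>2 \<le> 1" using assms by (simp add: power_le_one)
  then have nz: "d \<noteq> 0" "1 - t \<noteq> 0" "1 + t \<noteq> 0" using assms by (auto simp: d_def)
  have f: "1 - t\<^sup>2 = (1 - t) * (1 + t)" by (simp add: power2_eq_square algebra_simps)
  show ?thesis
    unfolding crit_def d_def [symmetric] f using nz
    by (simp add: divide_simps power_mult_distrib) algebra
qed

text \<open>By minimality \<open>crit a\<close> can be raised to \<open>crit t\<close>, for which
  equality holds. The pole t = 1 of \<open>crit\<close> is separate; there all terms but the first
  vanish.\<close>

lemma bohr_large:
  assumes a: "0 < a" "a < 1" "psi a = 0" and t: "0 \<le> t" "t \<le> 1"
  shows "t + (1 - t\<^sup>2) / (3 - t) + 16 * ((1 - t\<^sup>2) / (9 - t\<^sup>2))\<^sup>2 + 81 * crit a * ((1 - t\<^sup>2) / (9 - t\<^sup>2)) ^ 4 \<le> 1"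
proof (cases "t = 1")
  case False
  have "81 * crit a * ((1 - t\<^sup>2) / (9 - t\<^sup>2)) ^ 4 \<le> 81 * crit t * ((1 - t\<^sup>2) / (9 - t\<^sup>2)) ^ 4"
    using crit_minimal [OF a, of t] t False by (intro mult_right_mono mult_left_mono zero_le_even_power) auto
  then show ?thesis
    using bohr_sum_identity [OF t] crit_mult_pow [of t] t False by simp
qed simp

text \<open>Evaluation on an interval: the first term is bounded at the right end \<open>h\<close>,
  the remaining terms decrease in t and are bounded at the left end \<open>l\<close>.
  \<open>s\<close> and \<open>U\<close> stand for upper roundings of the square root and of the
  quotient at \<open>l\<close>.\<close>

lemma bohr_small_piece:
  fixes t :: real
  assumes "0 \<le> l" "l \<le> t" "t \<le> h" "h \<le> 1" and s: "1 - l\<^sup>2 \<le> 8 * s\<^sup>2" "0 \<le> s"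
    and U: "1 - l\<^sup>2 \<le> U * (9 - l\<^sup>2)" and le: "h + s + 16 * U\<^sup>2 + 81 * 18.6096 * U ^ 4 \<le> 1"
    and c: "0 \<le> c" "c \<le> 18.6096"
  shows "t + sqrt ((1 - t\<^sup>2) / 8) + 16 * ((1 - t\<^sup>2) / (9 - t\<^sup>2))\<^sup>2 + 81 * c * ((1 - t\<^sup>2) / (9 - t\<^sup>2)) ^ 4 \<le> 1"
proof -
  have sq: "l\<^sup>2 \<le> t\<^sup>2" "t\<^sup>2 \<le> 1"
    using assms by (auto intro: power_mono power_le_one)
  have "sqrt ((1 - t\<^sup>2) / 8) \<le> s"
    using s sq by (intro real_le_lsqrt) auto
  moreover have u: "0 \<le> (1 - t\<^sup>2) / (9 - t\<^sup>2)" "(1 - t\<^sup>2) / (9 - t\<^sup>2) \<le> U"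
  proof -
    show "0 \<le> (1 - t\<^sup>2) / (9 - t\<^sup>2)" using sq by simp
    have "(1 - t\<^sup>2) / (9 - t\<^sup>2) \<le> (1 - l\<^sup>2) / (9 - l\<^sup>2)"
      using sq by (simp add: divide_simps) (simp add: algebra_simps)
    also have "\<dots> \<le> U" using U sq by (simp add: divide_simps)
    finally show "(1 - t\<^sup>2) / (9 - t\<^sup>2) \<le> U" .
  qed
  moreover have "16 * ((1 - t\<^sup>2) / (9 - t\<^sup>2))\<^sup>2 \<le> 16 * U\<^sup>2"
    using u by (intro mult_left_mono power_mono) auto
  moreover have "81 * c * ((1 - t\<^sup>2) / (9 - t\<^sup>2)) ^ 4 \<le> 81 * 18.6096 * U ^ 4"
    using u c by (intro mult_mono power_mono) auto
  ultimately show ?thesis using le assms by linarith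
qed

lemma bohr_small:
  fixes t :: real
  assumes t: "0 \<le> t" "t \<le> 1 / 3" and c: "0 \<le> c" "c \<le> 18.6096"
  shows "t + sqrt ((1 - t\<^sup>2) / 8) + 16 * ((1 - t\<^sup>2) / (9 - t\<^sup>2))\<^sup>2 + 81 * c * ((1 - t\<^sup>2) / (9 - t\<^sup>2)) ^ 4 \<le> 1"
proof -
  \<comment> \<open>The pieces shorten towards 1/3, where there is less room than at 0. The decimals
    below are upper roundings at the left ends.\<close>
  consider "t \<le> 0.2" | "0.2 \<le> t" "t \<le> 0.27" | "0.27 \<le> t" "t \<le> 0.31" | "0.31 \<le> t"
    by linarith
  then show ?thesis
  proof cases
    case 1
    with t c show ?thesis
      by (intro bohr_small_piece [of 0 t "0.2" "0.3536" "0.11112"]) (auto simp: power_divide)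
  next
    case 2
    with t c show ?thesis
      by (intro bohr_small_piece [of "0.2" t "0.27" "0.34642" "0.10715"]) (auto simp: power_divide)
  next
    case 3
    with t c show ?thesis
      by (intro bohr_small_piece [of "0.27" t "0.31" "0.34043" "0.10386"]) (auto simp: power_divide)
  next
    case 4
    with t c show ?thesis
      by (intro bohr_small_piece [of "0.31" t "1 / 3" "0.33615" "0.10152"]) (auto simp: power_divide)
  qed
qed

section \<open>The improved Bohr inequality\<close>

text \<open>All terms are bounded by their estimates at radius 1/3, which reduces the claim to
  \<open>bohr_large\<close> for |a_0| \<ge> 1/3 and to \<open>bohr_small\<close> otherwise.\<close>

lemma bohr_area_inequality:
  assumes a: "0.5672839 \<le> a" "a \<le> 0.567284" "psi a = 0"
    and f: "f holomorphic_on ball 0 1" and f_le: "\<And>z. norm z < 1 \<Longrightarrow> norm (f z) \<le> 1"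
    and r: "0 \<le> r" "r \<le> 1 / 3"
  shows "M (lambda_of a) f r \<le> 1"
proof -
  define x where "x k = norm (fps_nth (fps_expansion f 0) k)" for k
  define t where "t = x 0"
  define u where "u = (1 - t\<^sup>2) / (9 - t\<^sup>2)"
  define A where "A = image_area f r / pi"
  define B where "B = (if 1 / 3 \<le> t then (1 - t\<^sup>2) / (3 - t) else sqrt ((1 - t\<^sup>2) / 8))"
  have t: "0 \<le> t" "t \<le> 1"
    using f_le [of 0] by (auto simp: t_def x_def fps_expansion_def)
  have lam: "lambda_of a = crit a"
    using a by (intro lambda_of_eq_crit) auto
  have lam_le: "18.6095 \<le> crit a" "crit a < 18.6096"
    using crit_bounds [OF a] by auto
  have pow_le: "r ^ k \<le> (1 / 3) ^ k" for k
    using r by (intro power_mono) auto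
  have "(\<Sum>k<n. x (Suc k) * (1 / 3) ^ Suc k) \<le> B" for n
    using coeff_sum_le_large [OF f f_le, of n] coeff_sum_le_small [OF f f_le, of n]
    unfolding B_def t_def x_def by auto
  moreover have "(\<Sum>k<n. x (Suc k) * r ^ Suc k) \<le> (\<Sum>k<n. x (Suc k) * (1 / 3) ^ Suc k)" for n
    unfolding x_def by (intro sum_mono mult_left_mono pow_le) auto
  ultimately have tail: "(\<Sum>k<n. x (Suc k) * r ^ Suc k) \<le> B" for n
    using order.trans by blast
  have B: "0 \<le> B" using tail [of 0] by simp
  have "(\<Sum>k<n. x k * r ^ k) \<le> t + B" for n
    using tail t B by (cases n) (simp_all only: sum.lessThan_Suc_shift lessThan_0 sum.empty, auto simp: t_def)
  moreover have "0 \<le> x k * r ^ k" for k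
    using r by (simp add: x_def)
  ultimately have sum_le: "(\<Sum>k. x k * r ^ k) \<le> t + B"
    by (intro suminf_le_const summableI_nonneg_bounded)
  have "(\<Sum>k<n. real (Suc k) * (norm (fps_nth (fps_expansion f 0) (Suc k)))\<^sup>2 * r ^ (2 * Suc k)) \<le> 9 * u\<^sup>2" for n
  proof -
    have "(\<Sum>k<n. real (Suc k) * (norm (fps_nth (fps_expansion f 0) (Suc k)))\<^sup>2 * r ^ (2 * Suc k)) \<le>
        (\<Sum>k<n. real (Suc k) * (norm (fps_nth (fps_expansion f 0) (Suc k)))\<^sup>2 * (1 / 3) ^ (2 * Suc k))"
      by (intro sum_mono mult_left_mono pow_le) auto
    also have "\<dots> \<le> 9 * (1 - t\<^sup>2)\<^sup>2 / (9 - t\<^sup>2)\<^sup>2"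
      unfolding t_def x_def by (rule area_coeff_sum_le [OF f]) (fact f_le)
    finally show ?thesis by (simp add: u_def power_divide)
  qed
  then have "image_area f r \<le> pi * (9 * u\<^sup>2)"
    using r by (intro image_area_le f) auto
  then have A_le: "A \<le> 9 * u\<^sup>2"
    by (simp add: A_def divide_le_eq mult.commute)
  \<comment> \<open>Nonnegativity is what lets the bound on the area be squared.\<close>
  have A: "0 \<le> A"
    by (simp add: A_def image_area_def)
  have "A\<^sup>2 \<le> (9 * u\<^sup>2)\<^sup>2"
    using A A_le by (intro power_mono)
  then have "crit a * A\<^sup>2 \<le> crit a * (81 * u ^ 4)"
    using lam_le by (intro mult_left_mono) (auto simp: power_mult_distrib simp flip: power_mult)
  then have "M (lambda_of a) f r \<le> t + B + 16 * u\<^sup>2 + 81 * crit a * u ^ 4"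
    using sum_le A_le unfolding M_def lam A_def [symmetric] x_def [symmetric] by simp
  also have "\<dots> \<le> 1"
    using bohr_large [of a t] bohr_small [of t "crit a"] a t lam_le unfolding B_def u_def by auto
  finally show ?thesis .
qed

text \<open>For the Moebius map the normalised area is exactly 9 u^2, so \<open>M\<close> is the
  left-hand side of \<open>bohr_large\<close> at t = a, where the weight \<open>crit a\<close> makes
  it equal to 1.\<close>

lemma bohr_area_equality:
  assumes a: "0 < a" "a < 3 / 5" "psi a = 0"
  shows "M (lambda_of a) (\<lambda>z. (of_real a - z) / (1 - of_real a * z)) (1 / 3) = 1"
proof -
  define u where "u = (1 - a\<^sup>2) / (9 - a\<^sup>2)"
  have "1 - a\<^sup>2 * (1 / 3)\<^sup>2 = (9 - a\<^sup>2) / 9"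
    by (simp add: power_divide)
  moreover have "1 / 3 * x / (y / 9) = 3 * (x / y)" for x y :: real
    by simp
  ultimately have "1 / 3 * (1 - a\<^sup>2) / (1 - a\<^sup>2 * (1 / 3)\<^sup>2) = 3 * u"
    by (simp only: u_def)
  then have "image_area (\<lambda>z. (of_real a - z) / (1 - of_real a * z)) (1 / 3) / pi = 9 * u\<^sup>2"
    using image_area_moebius [of a "1 / 3"] a by (simp add: power_mult_distrib)
  then have "M (lambda_of a) (\<lambda>z. (of_real a - z) / (1 - of_real a * z)) (1 / 3) =
      a + (1 - a\<^sup>2) / (3 - a) + 16 * u\<^sup>2 + 81 * crit a * u ^ 4"
    using coeff_sum_moebius [of a] lambda_of_eq_crit [OF a] a
    by (simp add: M_def power_mult_distrib flip: power_mult)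
  also have "\<dots> = 1"
    using bohr_sum_identity [of a] crit_mult_pow [of a] a by (simp add: u_def)
  finally show ?thesis .
qed

theorem theorem1:
  shows "\<exists>a::real. 0 < a \<and> a < 1 \<and> psi a = 0 \<and>
    (\<forall>t. 0 < t \<and> t < 1 \<and> psi t = 0 \<longrightarrow> t = a) \<and>
    \<bar>a - 0.567284\<bar> < 0.0000005 \<and>
    18.6095 \<le> lambda_of a \<and> lambda_of a < 18.6096 \<and>
    (\<forall>(f :: complex \<Rightarrow> complex) (r :: real).
       f holomorphic_on ball 0 1 \<and> (\<forall>z\<in>ball 0 1. norm (f z) \<le> 1) \<and> 0 \<le> r \<and> r \<le> 1/3
         \<longrightarrow> M (lambda_of a) f r \<le> 1) \<and>
    (let g = (\<lambda>z :: complex. (of_real a - z) / (1 - of_real a * z)) in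
       g holomorphic_on ball 0 1 \<and> (\<forall>z\<in>ball 0 1. norm (g z) \<le> 1) \<and>
       M (lambda_of a) g (1/3) = 1)"
proof -
  obtain a where a: "0.5672839 \<le> a" "a \<le> 0.567284" "psi a = 0"
    by (rule psi_root)
  then have pos: "0 < a" "a < 1" "a < 3 / 5" by auto
  have uniq: "t = a" if "0 < t" "psi t = 0" for t
    using psi_strict_mono [of t a] psi_strict_mono [of a t] that a pos by (cases t a rule: linorder_cases) auto
  have approx: "\<bar>a - 0.567284\<bar> < 0.0000005"
    using a by (auto simp: abs_less_iff)
  have lam: "18.6095 \<le> lambda_of a" "lambda_of a < 18.6096"
    using crit_bounds [OF a] lambda_of_eq_crit [OF pos(1,3) a(3)] by auto
  have bound: "M (lambda_of a) f r \<le> 1"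
    if "f holomorphic_on ball 0 1 \<and> (\<forall>z\<in>ball 0 1. norm (f z) \<le> 1) \<and> 0 \<le> r \<and> r \<le> 1 / 3" for f r
    using that by (intro bohr_area_inequality a) auto
  have "norm ((of_real a - z) / (1 - of_real a * z)) \<le> 1" if "z \<in> ball 0 1" for z :: complex
    using that by (intro moebius_norm_le_1 pos) auto
  then show ?thesis
    unfolding Let_def
    by (intro exI [of _ a] conjI allI impI ballI pos(1,2) a(3) approx lam bound
        moebius_holomorphic bohr_area_equality pos(3)) (auto intro: uniq)
qed

end
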